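(* Suppose $\varphi$ is an elliptic automorphism of the open unit disk $D$ of order $2$ and the fixed point of $\varphi$ in $D$ is $a\in D\setminus\{0\}$. Then the numerical range $W(C_\varphi)$ of the composition operator $C_\varphi$ on the Hardy space $H^2(D)$ is the open ellipse with foci $\pm 1$ and semi-major axis $\frac{1+|a|^2}{1-|a|^2}$; that is, $$W(C_\varphi)=\left\{w\in\mathbb{C}: |w-1|+|w+1|<2\,\frac{1+|a|^2}{1-|a|^2}\right\}.$$
   Context: $D$ is the open unit disk in $\mathbb{C}$. $H^2(D)$ is the Hardy space of the disk, a Hilbert space with inner product $\langle f,g\rangle=\lim_{r\to1^-}\int_0^{2\pi} f(re^{i\theta})\overline{g(re^{i\theta})}\frac{d\theta}{2\pi}$. For a holomorphic self-map $\varphi$ of $D$, $C_\varphi$ is the bounded operator $C_\varphi f=f\circ\varphi$ on $H^2(D)$. The numerical range of a bounded operator $T$ on a Hilbert space $\mathscr{H}$ is $W(T)=\{\langle Tf,f\rangle: f\in\mathscr{H},\ \|f\|=1\}$. An elliptic automorphism of $D$ is a holomorphic automorphism of $D$, other than the identity, having a (unique) fixed point in $D$; its order is $p$ if $p$ is the least positive integer such that its $p$-th iterate is the identity. "Open ellipse" means the open region bounded by the ellipse. *)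

theory Defs
  imports "HOL-Complex_Analysis.Complex_Analysis"
begin

abbreviation unit_disk :: "complex set" where
  "unit_disk \<equiv> ball 0 1"

text \<open>
  A function on the unit disk is represented by the function on the complex plane that agrees
  with it on the disk and vanishes elsewhere, so that equality of elements of the Hardy space
  is equality of functions.
\<close>

definition hardy_space :: "(complex \<Rightarrow> complex) set" where
  "hardy_space = {f. f holomorphic_on unit_disk \<and> (\<forall>z. z \<notin> unit_disk \<longrightarrow> f z = 0) \<and>
     bdd_above ((\<lambda>r. integral {0..2*pi} (\<lambda>\<theta>. (cmod (f (of_real r * cis \<theta>)))\<^sup>2) / (2*pi)) ` {0..<1::real})}"

text \<open>The limit below exists for all elements of the Hardy space.\<close>

definition hardy_inner :: "(complex \<Rightarrow> complex) \<Rightarrow> (complex \<Rightarrow> complex) \<Rightarrow> complex" where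
  "hardy_inner f g = Lim (at_left (1::real))
     (\<lambda>r. integral {0..2*pi} (\<lambda>\<theta>. f (of_real r * cis \<theta>) * cnj (g (of_real r * cis \<theta>))) / of_real (2*pi))"

definition composition_operator ::
  "(complex \<Rightarrow> complex) \<Rightarrow> (complex \<Rightarrow> complex) \<Rightarrow> complex \<Rightarrow> complex" where
  "composition_operator \<phi> f = (\<lambda>z. if z \<in> unit_disk then f (\<phi> z) else 0)"

text \<open>
  The Hilbert space is given by its carrier \<open>H\<close> and its inner product \<open>ip\<close>, linear in the first
  argument; the condition on \<open>ip f f\<close> says that \<open>f\<close> has norm 1.
\<close>

definition numerical_range ::
  "'a set \<Rightarrow> ('a \<Rightarrow> 'a \<Rightarrow> complex) \<Rightarrow> ('a \<Rightarrow> 'a) \<Rightarrow> complex set" where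
  "numerical_range H ip T = {ip (T f) f | f. f \<in> H \<and> sqrt (Re (ip f f)) = 1}"

definition disk_automorphism :: "(complex \<Rightarrow> complex) \<Rightarrow> bool" where
  "disk_automorphism \<phi> \<longleftrightarrow> \<phi> holomorphic_on unit_disk \<and> bij_betw \<phi> unit_disk unit_disk"

definition elliptic_automorphism :: "(complex \<Rightarrow> complex) \<Rightarrow> bool" where
  "elliptic_automorphism \<phi> \<longleftrightarrow> disk_automorphism \<phi> \<and> \<not> (\<forall>z\<in>unit_disk. \<phi> z = z) \<and>
     (\<exists>z\<in>unit_disk. \<phi> z = z)"

definition has_order :: "(complex \<Rightarrow> complex) \<Rightarrow> nat \<Rightarrow> bool" where
  "has_order \<phi> p \<longleftrightarrow> 0 < p \<and> (\<forall>z\<in>unit_disk. (\<phi> ^^ p) z = z) \<and>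
     (\<forall>q. 0 < q \<and> q < p \<longrightarrow> \<not> (\<forall>z\<in>unit_disk. (\<phi> ^^ q) z = z))"

end

theory Submission
  imports Defs
begin

text \<open>
  The involution \<open>\<phi>\<close> is \<open>z \<mapsto> (b - z) / (1 - cnj b z)\<close> with \<open>b = 2a / (1 + |a|\<^sup>2)\<close>: conjugating by
  the automorphism that exchanges \<open>0\<close> and \<open>a\<close> moves the fixed point to the origin, where the Schwarz
  lemma leaves only \<open>z \<mapsto> -z\<close> (\<open>elliptic_order_2_eq_disk_swap\<close>). So \<open>C = C\<^sub>\<phi>\<close> is a linear involution of
  \<open>H\<^sup>2\<close>, every \<open>f\<close> is a sum \<open>u + v\<close> with \<open>C u = u\<close> and \<open>C v = -v\<close>, and
  \<open>\<langle>C f, f\<rangle> = |u|\<^sup>2 - |v|\<^sup>2 + 2 i Im \<langle>u, v\<rangle>\<close> while \<open>|f|\<^sup>2 = |u|\<^sup>2 + |v|\<^sup>2 + 2 Re \<langle>u, v\<rangle>\<close>. The numerical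
  range of an involution is therefore determined by the angle between its two eigenspaces. If \<open>c\<close> is the
  supremum of \<open>|\<langle>u, v\<rangle>| / (|u| |v|)\<close> and is not attained, elementary algebra shows that it is the open
  ellipse with foci \<open>\<plusminus>1\<close> and semi-major axis \<open>1 / sqrt (1 - c\<^sup>2)\<close> (\<open>numerical_range_involution\<close>).
  It remains to see that \<open>c = |b|\<close>, without attainment.

  On the unit circle, \<open>\<phi>\<close> transports Lebesgue measure to the Poisson measure of \<open>b\<close>. In terms of
  the Szego kernel \<open>k(z) = 1 / (1 - cnj b z)\<close> this reads
  \<open>\<langle>C f, C g\<rangle> = (1 - |b|\<^sup>2) \<langle>k f, k g\<rangle>\<close> (\<open>disk_swap_comp_nsq\<close>, \<open>disk_swap_comp_inner\<close>). For
  polynomials the identity follows by induction on the degree from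
  \<open>f = f(0) + z f\<^sub>1\<close>, because multiplication by \<open>z\<close> and by \<open>\<phi>\<close> are isometries and \<open>k\<close> reproduces point
  values at \<open>b\<close>; density of the polynomials gives the rest.

  For eigenfunctions \<open>u\<close>, \<open>v\<close> put \<open>h = k u\<close> and \<open>g = k v\<close>. Expanding \<open>u = h - cnj b z h\<close> and
  \<open>v = g - cnj b z g\<close> in \<open>\<langle>u, v\<rangle> = -\<langle>C u, C v\<rangle> = -(1 - |b|\<^sup>2) \<langle>h, g\<rangle>\<close> gives
  \<open>2 \<langle>h, g\<rangle> = b \<langle>h, z g\<rangle> + cnj b \<langle>z h, g\<rangle>\<close>, so \<open>|\<langle>h, g\<rangle>| \<le> |b| |h| |g|\<close> by the Cauchy-Schwarz
  inequality, which is the wanted bound since \<open>|u|\<^sup>2 = (1 - |b|\<^sup>2) |h|\<^sup>2\<close> and likewise for \<open>v\<close>. Equality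
  would make \<open>h\<close> proportional to \<open>z g\<close> and \<open>z h\<close> proportional to \<open>g\<close>, which is impossible for nonzero
  functions (\<open>eigenfunctions_angle\<close>). For the sharpness of \<open>|b|\<close> one takes \<open>u = f + C f\<close> and
  \<open>v = f - C f\<close>, where \<open>k f\<close> is the Szego kernel of a point tending to \<open>b / |b|\<close>
  (\<open>eigenfunctions_angle_sharp\<close>).
\<close>

section \<open>Algebra of the ellipse\<close>

text \<open>
  The hypothesis on \<open>M\<close> says that the ellipse with foci \<open>\<plusminus>1\<close> and semi-major axis \<open>M\<close> has eccentricity
  \<open>1 / M = sqrt (1 - c\<^sup>2)\<close>, hence semi-minor axis \<open>c M\<close>. The equation on the right is the Cartesian one,
  multiplied out so as to avoid divisions. Squaring twice gives the equivalence; the sign condition lost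
  at the second squaring holds automatically inside the ellipse.
\<close>
lemma ellipse_focal_iff:
  fixes w :: complex and c :: real
  assumes c: "0 < c" "c < 1" and M: "M\<^sup>2 * (1 - c\<^sup>2) = 1" "0 < M"
  shows "cmod (w - 1) + cmod (w + 1) < 2 * M \<longleftrightarrow>
    (1 - c\<^sup>2) * (c\<^sup>2 * (Re w)\<^sup>2 + (Im w)\<^sup>2) < c\<^sup>2"
proof -
  define X Y S where "X = Re w" and "Y = Im w" and "S = X\<^sup>2 + Y\<^sup>2 + 1"
  define d where "d = cmod (w - 1) * cmod (w + 1)"
  have c2: "0 < 1 - c\<^sup>2" "c\<^sup>2 < 1" using c by (simp_all add: power_less_one_iff)
  have "M\<^sup>2 = 1 + M\<^sup>2 * c\<^sup>2" using M(1) by (simp add: algebra_simps)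
  moreover have "0 < M\<^sup>2 * c\<^sup>2" using M(2) c by simp
  ultimately have M1: "M\<^sup>2 > 1" by linarith
  have sq1: "(cmod (w - 1))\<^sup>2 = (X - 1)\<^sup>2 + Y\<^sup>2" and sq2: "(cmod (w + 1))\<^sup>2 = (X + 1)\<^sup>2 + Y\<^sup>2"
    by (simp_all add: cmod_power2 X_def Y_def)
  have d2: "d\<^sup>2 = S\<^sup>2 - 4 * X\<^sup>2"
    unfolding d_def power_mult_distrib sq1 sq2 S_def by algebra
  have d0: "d \<ge> 0" by (simp add: d_def)
  have sum2: "(cmod (w - 1) + cmod (w + 1))\<^sup>2 = 2 * S + 2 * d"
    unfolding power2_sum sq1 sq2 d_def S_def by (simp add: algebra_simps power2_eq_square)
  have "cmod (w - 1) + cmod (w + 1) < 2 * M \<longleftrightarrow> (cmod (w - 1) + cmod (w + 1))\<^sup>2 < (2 * M)\<^sup>2"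
    using M(2) power_mono_iff[of "2 * M" "cmod (w - 1) + cmod (w + 1)" 2]
    by (simp add: linorder_not_le[symmetric] del: power_mono_iff)
  also have "\<dots> \<longleftrightarrow> d < 2 * M\<^sup>2 - S"
    unfolding sum2 by (auto simp: power_mult_distrib)
  also have "\<dots> \<longleftrightarrow> 0 < 2 * M\<^sup>2 - S \<and> d\<^sup>2 < (2 * M\<^sup>2 - S)\<^sup>2"
    using d0 by (smt (verit) power2_less_imp_less power_strict_mono pos2)
  also have "d\<^sup>2 < (2 * M\<^sup>2 - S)\<^sup>2 \<longleftrightarrow> M\<^sup>2 * S - X\<^sup>2 < M\<^sup>2 * M\<^sup>2"
    unfolding d2 by (auto simp: power2_eq_square algebra_simps)
  also have "\<dots> \<longleftrightarrow> (M\<^sup>2 - 1) * X\<^sup>2 + M\<^sup>2 * Y\<^sup>2 < M\<^sup>2 * (M\<^sup>2 - 1)"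
    unfolding S_def by (auto simp: algebra_simps)
  also have "0 < 2 * M\<^sup>2 - S \<and> (M\<^sup>2 - 1) * X\<^sup>2 + M\<^sup>2 * Y\<^sup>2 < M\<^sup>2 * (M\<^sup>2 - 1) \<longleftrightarrow>
      (M\<^sup>2 - 1) * X\<^sup>2 + M\<^sup>2 * Y\<^sup>2 < M\<^sup>2 * (M\<^sup>2 - 1)"
  proof -
    have "0 < 2 * M\<^sup>2 - S" if "(M\<^sup>2 - 1) * X\<^sup>2 + M\<^sup>2 * Y\<^sup>2 < M\<^sup>2 * (M\<^sup>2 - 1)"
    proof -
      have "(M\<^sup>2 - 1) * (X\<^sup>2 + Y\<^sup>2) \<le> (M\<^sup>2 - 1) * X\<^sup>2 + M\<^sup>2 * Y\<^sup>2"
        by (simp add: algebra_simps)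
      with that have "(M\<^sup>2 - 1) * (X\<^sup>2 + Y\<^sup>2) < (M\<^sup>2 - 1) * M\<^sup>2"
        by (simp add: mult.commute)
      then have "X\<^sup>2 + Y\<^sup>2 < M\<^sup>2" using M1 by simp
      then show ?thesis using M1 by (simp add: S_def)
    qed
    then show ?thesis by blast
  qed
  also have "\<dots> \<longleftrightarrow> (1 - c\<^sup>2) * (c\<^sup>2 * X\<^sup>2 + Y\<^sup>2) < c\<^sup>2"
  proof -
    have M2: "M\<^sup>2 = 1 / (1 - c\<^sup>2)" using M c2 by (simp add: field_simps)
    have M3: "M\<^sup>2 - 1 = c\<^sup>2 / (1 - c\<^sup>2)" using M2 c2 by (simp add: field_simps)
    have "(M\<^sup>2 - 1) * X\<^sup>2 + M\<^sup>2 * Y\<^sup>2 = (c\<^sup>2 * X\<^sup>2 + Y\<^sup>2) / (1 - c\<^sup>2)"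
      unfolding M3 by (simp add: M2 add_divide_distrib)
    moreover have "M\<^sup>2 * (M\<^sup>2 - 1) = c\<^sup>2 / (1 - c\<^sup>2) / (1 - c\<^sup>2)"
      unfolding M3 by (simp add: M2)
    ultimately show ?thesis using c2
      by (simp add: pos_less_divide_eq mult.commute divide_less_cancel)
  qed
  finally show ?thesis by (simp add: X_def Y_def)
qed

text \<open>
  Here \<open>p = |u|\<^sup>2\<close>, \<open>q = |v|\<^sup>2\<close> and \<open>R + i J = \<langle>u, v\<rangle>\<close> for the two eigencomponents of a unit vector. The
  angle bound turns \<open>(p - q)\<^sup>2 = (1 - 2 R)\<^sup>2 - 4 p q\<close> into a quadratic in \<open>R\<close> whose maximum is the right-hand
  side. If a component vanishes, the point is a focus, which is interior because \<open>c > 0\<close>.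
\<close>
lemma ellipse_bound:
  fixes c p q R J :: real
  assumes c: "0 < c" "c < 1" and sum: "p + q + 2 * R = 1"
    and le: "R\<^sup>2 + J\<^sup>2 \<le> c\<^sup>2 * (p * q)"
    and less: "p \<noteq> 0 \<Longrightarrow> q \<noteq> 0 \<Longrightarrow> R\<^sup>2 + J\<^sup>2 < c\<^sup>2 * (p * q)"
  shows "(1 - c\<^sup>2) * (c\<^sup>2 * (p - q)\<^sup>2 + (2 * J)\<^sup>2) < c\<^sup>2"
proof (cases "p = 0 \<or> q = 0")
  case True
  then have "R = 0 \<and> J = 0" using le by (auto simp: sum_power2_le_zero_iff)
  moreover from this have "(p - q)\<^sup>2 = 1" using True sum by auto
  ultimately show ?thesis using c by (simp add: algebra_simps)
next
  case False
  have c2: "0 < 1 - c\<^sup>2" using c by (simp add: power_less_one_iff)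
  have pq: "(p - q)\<^sup>2 = (1 - 2 * R)\<^sup>2 - 4 * (p * q)"
  proof -
    have "1 - 2 * R = p + q" using sum by simp
    then show ?thesis by algebra
  qed
  have "c\<^sup>2 * (p - q)\<^sup>2 + (2 * J)\<^sup>2 < c\<^sup>2 * (1 - 2 * R)\<^sup>2 - 4 * R\<^sup>2"
    using less False unfolding pq by (simp add: algebra_simps)
  then have "(1 - c\<^sup>2) * (c\<^sup>2 * (p - q)\<^sup>2 + (2 * J)\<^sup>2) < (1 - c\<^sup>2) * (c\<^sup>2 * (1 - 2 * R)\<^sup>2 - 4 * R\<^sup>2)"
    using c2 by simp
  also have "\<dots> = c\<^sup>2 - (c\<^sup>2 + 2 * R * (1 - c\<^sup>2))\<^sup>2" by algebra
  also have "\<dots> \<le> c\<^sup>2" by simp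
  finally show ?thesis .
qed

text \<open>
  The converse for two unit eigenvectors with \<open>\<langle>u, v\<rangle> = t\<close>: given the target point \<open>X + i Y\<close>, the
  weights \<open>p = |x|\<^sup>2\<close>, \<open>q = |y|\<^sup>2\<close> and \<open>R + i J = x cnj y\<close> of a vector \<open>x u + y v\<close> are determined by a
  quadratic equation for \<open>R\<close>, whose discriminant is nonnegative exactly on the closed ellipse.
\<close>
lemma ellipse_parametrisation:
  fixes t X Y :: real
  assumes t: "0 < t" "t < 1" and XY: "(1 - t\<^sup>2) * (t\<^sup>2 * X\<^sup>2 + Y\<^sup>2) \<le> t\<^sup>2"
  obtains p q R J where "0 \<le> p" "0 \<le> q" "p + q + 2 * t * R = 1" "p - q = X" "2 * t * J = Y"
    "R\<^sup>2 + J\<^sup>2 = p * q"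
proof -
  \<comment> \<open>up to a factor \<open>16\<close> the discriminant of the quadratic equation for \<open>R\<close>\<close>
  define D where "D = 1 - (1 - t\<^sup>2) * (X\<^sup>2 + Y\<^sup>2 / t\<^sup>2)"
  define s R J where "s = sqrt D" and "R = (s - t) / (2 * (1 - t\<^sup>2))" and "J = Y / (2 * t)"
  define p q where "p = (1 - 2 * t * R + X) / 2" and "q = (1 - 2 * t * R - X) / 2"
  have t2: "0 < 1 - t\<^sup>2" using t by (simp add: power_less_one_iff)
  have t0: "t\<^sup>2 > 0" using t by simp
  have "(1 - t\<^sup>2) * (X\<^sup>2 + Y\<^sup>2 / t\<^sup>2) = (1 - t\<^sup>2) * (t\<^sup>2 * X\<^sup>2 + Y\<^sup>2) / t\<^sup>2"
    using t0 by (simp add: field_simps)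
  also have "\<dots> \<le> 1" using XY t0 by (simp add: divide_le_eq)
  finally have D0: "0 \<le> D" by (simp add: D_def)
  have D1: "D \<le> 1" using t2 by (simp add: D_def)
  have s: "s\<^sup>2 = D" "0 \<le> s" "s \<le> 1" using D0 D1 by (simp_all add: s_def)
  have R1: "1 - 2 * t * R = (1 - t * s) / (1 - t\<^sup>2)"
    using t2 by (simp add: R_def field_simps power2_eq_square)
  have "t * s \<le> 1" using t s by (simp add: mult_le_one)
  then have pos: "0 \<le> 1 - 2 * t * R" unfolding R1 using t2 by simp
  have R2: "2 * R = (s - t) / (1 - t\<^sup>2)" unfolding R_def times_divide_eq_right by (rule mult_divide_mult_cancel_left) simp
  have "(1 - 2 * t * R)\<^sup>2 - (2 * R)\<^sup>2 = ((1 - t * s)\<^sup>2 - (s - t)\<^sup>2) / (1 - t\<^sup>2)\<^sup>2"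
    unfolding R1 R2 power_divide by (rule diff_divide_distrib[symmetric])
  also have "(1 - t * s)\<^sup>2 - (s - t)\<^sup>2 = (1 - t\<^sup>2) * (1 - s\<^sup>2)"
    by algebra
  also have "\<dots> / (1 - t\<^sup>2)\<^sup>2 = (1 - D) / (1 - t\<^sup>2)"
    using t2 s by (simp add: power2_eq_square)
  also have "\<dots> = X\<^sup>2 + Y\<^sup>2 / t\<^sup>2" using t2 by (simp add: D_def)
  finally have key: "(1 - 2 * t * R)\<^sup>2 - X\<^sup>2 = (2 * R)\<^sup>2 + Y\<^sup>2 / t\<^sup>2" by simp
  have "2 * p = 1 - 2 * t * R + X" "2 * q = 1 - 2 * t * R - X"
    by (simp_all add: p_def q_def)
  then have "4 * (p * q) = (1 - 2 * t * R)\<^sup>2 - X\<^sup>2"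
    by algebra
  also have "\<dots> = 4 * (R\<^sup>2 + J\<^sup>2)"
    unfolding key J_def power_divide power_mult_distrib by simp
  finally have prod: "R\<^sup>2 + J\<^sup>2 = p * q" by simp
  have "X\<^sup>2 \<le> (1 - 2 * t * R)\<^sup>2" using key by (smt (verit) divide_nonneg_nonneg zero_le_power2)
  then have "\<bar>X\<bar> \<le> 1 - 2 * t * R" using pos by (simp add: abs_le_square_iff[symmetric])
  then have "0 \<le> p" "0 \<le> q" by (simp_all add: p_def q_def)
  moreover have "p + q + 2 * t * R = 1" "p - q = X" "2 * t * J = Y"
    using t by (simp_all add: p_def q_def J_def field_simps)
  ultimately show ?thesis using prod that by blast
qed

lemma complex_pair_with_product:
  fixes m :: complex
  assumes "0 \<le> p" "0 \<le> q" "(cmod m)\<^sup>2 = p * q"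
  obtains x y where "(cmod x)\<^sup>2 = p" "(cmod y)\<^sup>2 = q" "x * cnj y = m"
proof (cases "p = 0")
  case True
  show ?thesis
    by (rule that[of 0 "of_real (sqrt q)"]) (use assms True in auto)
next
  case False
  have "cmod (cnj m / of_real (sqrt p)) ^ 2 = q"
    using False assms by (simp add: norm_divide power_divide)
  then show ?thesis
    by (intro that[of "of_real (sqrt p)" "cnj m / of_real (sqrt p)"]) (use assms False in auto)
qed

section \<open>Numerical ranges of linear involutions\<close>

text \<open>
  Vectors are complex functions with pointwise operations and the space is a carrier set, so that the
  locale applies directly to a Hardy space given as a set of functions.
\<close>
locale function_inner_product =
  fixes H :: "('b \<Rightarrow> complex) set" and ip :: "('b \<Rightarrow> complex) \<Rightarrow> ('b \<Rightarrow> complex) \<Rightarrow> complex"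
  assumes lincomb_mem: "f \<in> H \<Longrightarrow> g \<in> H \<Longrightarrow> (\<lambda>z. x * f z + y * g z) \<in> H"
    and ip_lincomb: "f \<in> H \<Longrightarrow> g \<in> H \<Longrightarrow> h \<in> H \<Longrightarrow>
      ip (\<lambda>z. x * f z + y * g z) h = x * ip f h + y * ip g h"
    and ip_cnj: "f \<in> H \<Longrightarrow> g \<in> H \<Longrightarrow> ip g f = cnj (ip f g)"
    and ip_nonneg: "f \<in> H \<Longrightarrow> 0 \<le> Re (ip f f)"
    and ip_definite: "f \<in> H \<Longrightarrow> Re (ip f f) = 0 \<Longrightarrow> f = (\<lambda>z. 0)"
begin

definition nsq :: "('b \<Rightarrow> complex) \<Rightarrow> real" where
  "nsq f = Re (ip f f)"

lemma nsq_nonneg: "f \<in> H \<Longrightarrow> 0 \<le> nsq f"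
  by (simp add: nsq_def ip_nonneg)

lemma ip_self: "f \<in> H \<Longrightarrow> ip f f = of_real (nsq f)"
  using ip_cnj[of f f] by (simp add: nsq_def complex_eq_iff)

lemma ip_lincomb_right:
  assumes "f \<in> H" "g \<in> H" "h \<in> H"
  shows "ip h (\<lambda>z. x * f z + y * g z) = cnj x * ip h f + cnj y * ip h g"
proof -
  have "ip h (\<lambda>z. x * f z + y * g z) = cnj (x * ip f h + y * ip g h)"
    using assms by (simp add: ip_cnj[of "\<lambda>z. x * f z + y * g z" h] lincomb_mem ip_lincomb)
  then show ?thesis using assms ip_cnj[of f h] ip_cnj[of g h] by simp
qed

lemma ip_lincomb_both:
  assumes "f \<in> H" "g \<in> H" 
  shows "ip (\<lambda>z. x * f z + y * g z) (\<lambda>z. x' * f z + y' * g z) =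
    x * cnj x' * of_real (nsq f) + y * cnj y' * of_real (nsq g)
    + x * cnj y' * ip f g + y * cnj x' * cnj (ip f g)"
  using assms by (simp add: ip_lincomb ip_lincomb_right lincomb_mem ip_self ip_cnj[of f g] algebra_simps)

lemma nsq_lincomb:
  assumes "f \<in> H" "g \<in> H" 
  shows "nsq (\<lambda>z. x * f z + y * g z) =
    (cmod x)\<^sup>2 * nsq f + (cmod y)\<^sup>2 * nsq g + 2 * Re (x * cnj y * ip f g)"
  unfolding nsq_def[of "\<lambda>z. x * f z + y * g z"] ip_lincomb_both[OF assms] cmod_power2
  by (simp add: power2_eq_square algebra_simps)

text \<open>
  This identity is used twice: positivity of its left-hand side is the Cauchy-Schwarz inequality, and
  definiteness describes the case of equality.
\<close>
lemma cauchy_schwarz_defect: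
  assumes "f \<in> H" "g \<in> H"
  shows "nsq (\<lambda>z. of_real (nsq g) * f z + (- ip f g) * g z) =
    nsq g * (nsq f * nsq g - (cmod (ip f g))\<^sup>2)"
  unfolding nsq_lincomb[OF assms] norm_minus_cancel cmod_power2
  by (simp add: power2_eq_square algebra_simps)

lemma cauchy_schwarz:
  assumes "f \<in> H" "g \<in> H"
  shows "(cmod (ip f g))\<^sup>2 \<le> nsq f * nsq g"
proof (cases "nsq g = 0")
  case True
  then have "g = (\<lambda>z. 0)" using ip_definite assms by (simp add: nsq_def)
  then have "ip f g = 0" using ip_lincomb_right[of f f f 0 0] assms by simp
  then show ?thesis using True by simp
next
  case False
  then have "nsq g > 0" using nsq_nonneg assms by (simp add: less_le)
  moreover have "0 \<le> nsq g * (nsq f * nsq g - (cmod (ip f g))\<^sup>2)"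
    unfolding cauchy_schwarz_defect[OF assms, symmetric] by (intro nsq_nonneg lincomb_mem assms)
  ultimately show ?thesis by (simp add: zero_le_mult_iff)
qed

lemma cauchy_schwarz_eq:
  assumes "f \<in> H" "g \<in> H" "(cmod (ip f g))\<^sup>2 = nsq f * nsq g"
  shows "of_real (nsq g) * f z = ip f g * g z"
proof -
  have "(\<lambda>z. of_real (nsq g) * f z + (- ip f g) * g z) = (\<lambda>z. 0)"
    by (intro ip_definite lincomb_mem assms)
       (simp only: nsq_def[symmetric] cauchy_schwarz_defect[OF assms(1,2)], simp add: assms)
  then have "of_real (nsq g) * f z + (- ip f g) * g z = 0" by (rule fun_cong)
  then show ?thesis by simp
qed

lemma norm_diff_le:
  assumes "f \<in> H" "g \<in> H"
  shows "\<bar>sqrt (nsq f) - sqrt (nsq g)\<bar> \<le> sqrt (nsq (\<lambda>z. f z - g z))"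
proof (rule real_le_rsqrt)
  have "nsq (\<lambda>z. f z - g z) = nsq f + nsq g - 2 * Re (ip f g)"
    using nsq_lincomb[OF assms, of 1 "-1"] by simp
  moreover have "Re (ip f g) \<le> sqrt (nsq f) * sqrt (nsq g)"
  proof -
    have "cmod (ip f g) \<le> sqrt (nsq f * nsq g)"
      by (intro real_le_rsqrt cauchy_schwarz assms)
    then show ?thesis using complex_Re_le_cmod[of "ip f g"] by (simp add: real_sqrt_mult)
  qed
  ultimately show "\<bar>sqrt (nsq f) - sqrt (nsq g)\<bar>\<^sup>2 \<le> nsq (\<lambda>z. f z - g z)"
    using assms by (simp add: nsq_nonneg power2_diff)
qed

lemma norm_tendsto:
  assumes "\<And>n. F n \<in> H" "f \<in> H" "(\<lambda>n. nsq (\<lambda>z. F n z - f z)) \<longlonglongrightarrow> 0"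
  shows "(\<lambda>n. nsq (F n)) \<longlonglongrightarrow> nsq f"
proof -
  have "(\<lambda>n. sqrt (nsq (\<lambda>z. F n z - f z))) \<longlonglongrightarrow> 0"
    using tendsto_real_sqrt[OF assms(3)] by simp
  then have "(\<lambda>n. sqrt (nsq (F n)) - sqrt (nsq f)) \<longlonglongrightarrow> 0"
  proof (rule Lim_null_comparison[rotated])
    show "\<forall>\<^sub>F n in sequentially. norm (sqrt (nsq (F n)) - sqrt (nsq f)) \<le> sqrt (nsq (\<lambda>z. F n z - f z))"
      unfolding real_norm_def using norm_diff_le[OF assms(1,2)] by (intro always_eventually allI)
  qed
  then have "(\<lambda>n. sqrt (nsq (F n))) \<longlonglongrightarrow> sqrt (nsq f)" by (simp add: LIM_zero_iff)
  then have "(\<lambda>n. (sqrt (nsq (F n)))\<^sup>2) \<longlonglongrightarrow> (sqrt (nsq f))\<^sup>2" by (rule tendsto_power)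
  moreover have "(sqrt (nsq g))\<^sup>2 = nsq g" if "g \<in> H" for g
    using nsq_nonneg[OF that] by simp
  ultimately show ?thesis using assms(1,2) by simp
qed

text \<open>
  Identities are easier to prove for norms than for inner products; for linear maps nothing is lost.
\<close>
lemma polarization:
  assumes TH: "\<And>f. f \<in> H \<Longrightarrow> T f \<in> H" and SH: "\<And>f. f \<in> H \<Longrightarrow> S f \<in> H"
    and Tlin: "\<And>f g x y. f \<in> H \<Longrightarrow> g \<in> H \<Longrightarrow>
      T (\<lambda>z. x * f z + y * g z) = (\<lambda>z. x * T f z + y * T g z)"
    and Slin: "\<And>f g x y. f \<in> H \<Longrightarrow> g \<in> H \<Longrightarrow>
      S (\<lambda>z. x * f z + y * g z) = (\<lambda>z. x * S f z + y * S g z)"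
    and nsq_eq: "\<And>f. f \<in> H \<Longrightarrow> nsq (T f) = r * nsq (S f)"
    and fg: "f \<in> H" "g \<in> H"
  shows "ip (T f) (T g) = of_real r * ip (S f) (S g)"
proof -
  have *: "Re (x * ip (T f) (T g)) = r * Re (x * ip (S f) (S g))" for x
  proof -
    have "nsq (\<lambda>z. x * T f z + 1 * T g z) = r * nsq (\<lambda>z. x * S f z + 1 * S g z)"
      using nsq_eq[OF lincomb_mem[OF fg]] by (simp only: Tlin[OF fg] Slin[OF fg])
    then show ?thesis
      unfolding nsq_lincomb[OF TH[OF fg(1)] TH[OF fg(2)]] nsq_lincomb[OF SH[OF fg(1)] SH[OF fg(2)]]
      by (simp add: nsq_eq fg algebra_simps)
  qed
  show ?thesis using *[of 1] *[of "-\<i>"] by (simp add: complex_eq_iff)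
qed

text \<open>
  The hypotheses \<open>angle\<close> and \<open>sharp\<close> say that \<open>c\<close> is the cosine of the angle between the eigenspaces for
  \<open>1\<close> and \<open>-1\<close>, and that it is not attained; for this reason the ellipse is open. The inclusion of the ellipse uses a
  pair \<open>u\<close>, \<open>v\<close> whose cosine \<open>t\<close> is so close to \<open>c\<close> that the given point already lies in the smaller
  ellipse of \<open>t\<close>; that ellipse is filled by the vectors in the span of \<open>u\<close> and \<open>v\<close>.
\<close>
theorem numerical_range_involution:
  assumes TH: "\<And>f. f \<in> H \<Longrightarrow> T f \<in> H"
    and Tlin: "\<And>f g x y. f \<in> H \<Longrightarrow> g \<in> H \<Longrightarrow>
      T (\<lambda>z. x * f z + y * g z) = (\<lambda>z. x * T f z + y * T g z)"
    and TT: "\<And>f. f \<in> H \<Longrightarrow> T (T f) = f"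
    and c: "0 < c" "c < 1"
    and angle: "\<And>u v. u \<in> H \<Longrightarrow> v \<in> H \<Longrightarrow> T u = u \<Longrightarrow> T v = (\<lambda>z. - v z) \<Longrightarrow>
      nsq u \<noteq> 0 \<Longrightarrow> nsq v \<noteq> 0 \<Longrightarrow> (cmod (ip u v))\<^sup>2 < c\<^sup>2 * (nsq u * nsq v)"
    and sharp: "\<And>e. e < c \<Longrightarrow> \<exists>u\<in>H. \<exists>v\<in>H. T u = u \<and> T v = (\<lambda>z. - v z) \<and>
      nsq u \<noteq> 0 \<and> nsq v \<noteq> 0 \<and> e * sqrt (nsq u * nsq v) < cmod (ip u v)"
  shows "numerical_range H ip T =
    {w. (1 - c\<^sup>2) * (c\<^sup>2 * (Re w)\<^sup>2 + (Im w)\<^sup>2) < c\<^sup>2}"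
proof (intro equalityI subsetI)
  fix w assume "w \<in> numerical_range H ip T"
  then obtain f where f: "f \<in> H" "nsq f = 1" "w = ip (T f) f"
    by (auto simp: numerical_range_def nsq_def)
  define u v where "u = (\<lambda>z. 1/2 * f z + 1/2 * T f z)" and "v = (\<lambda>z. 1/2 * f z + (-1/2) * T f z)"
  have uH: "u \<in> H" and vH: "v \<in> H" unfolding u_def v_def by (intro lincomb_mem TH f)+
  have Tu: "T u = u"
    unfolding u_def by (subst Tlin) (simp_all add: TH TT f fun_eq_iff)
  have Tv: "T v = (\<lambda>z. - v z)"
    unfolding v_def by (subst Tlin) (simp_all add: TH TT f fun_eq_iff)
  have f_eq: "f = (\<lambda>z. 1 * u z + 1 * v z)" by (simp add: u_def v_def fun_eq_iff field_simps)
  have Tf_eq: "T f = (\<lambda>z. 1 * u z + (-1) * v z)"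
    by (simp add: u_def v_def fun_eq_iff field_simps)
  have one: "nsq u + nsq v + 2 * Re (ip u v) = 1"
    using f(2) nsq_lincomb[OF uH vH, of 1 1] unfolding f_eq[symmetric] by simp
  have w: "w = ip (\<lambda>z. 1 * u z + (-1) * v z) (\<lambda>z. 1 * u z + 1 * v z)"
    unfolding f_eq[symmetric] Tf_eq[symmetric] by (rule f(3))
  have "Re w = nsq u - nsq v" "Im w = 2 * Im (ip u v)"
    unfolding w ip_lincomb_both[OF uH vH] by simp_all
  moreover have "(1 - c\<^sup>2) * (c\<^sup>2 * (nsq u - nsq v)\<^sup>2 + (2 * Im (ip u v))\<^sup>2) < c\<^sup>2"
  proof (rule ellipse_bound[OF c one], goal_cases)
    case 1
    show ?case
    proof (cases "nsq u = 0 \<or> nsq v = 0")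
      case True
      then show ?thesis using cauchy_schwarz[OF uH vH] by (auto simp: cmod_power2)
    next
      case False
      then show ?thesis using angle[OF uH vH Tu Tv] by (simp add: cmod_power2)
    qed
  next
    case 2
    then show ?case using angle[OF uH vH Tu Tv] by (simp add: cmod_power2)
  qed
  ultimately show "w \<in> {w. (1 - c\<^sup>2) * (c\<^sup>2 * (Re w)\<^sup>2 + (Im w)\<^sup>2) < c\<^sup>2}" by simp
next
  fix w assume "w \<in> {w. (1 - c\<^sup>2) * (c\<^sup>2 * (Re w)\<^sup>2 + (Im w)\<^sup>2) < c\<^sup>2}"
  then have w: "(1 - c\<^sup>2) * (c\<^sup>2 * (Re w)\<^sup>2 + (Im w)\<^sup>2) - c\<^sup>2 < 0" by simp
  have "((\<lambda>t. (1 - t\<^sup>2) * (t\<^sup>2 * (Re w)\<^sup>2 + (Im w)\<^sup>2) - t\<^sup>2) \<longlongrightarrow>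
      (1 - c\<^sup>2) * (c\<^sup>2 * (Re w)\<^sup>2 + (Im w)\<^sup>2) - c\<^sup>2) (at_left c)"
    by (intro tendsto_intros)
  then have "eventually (\<lambda>t. (1 - t\<^sup>2) * (t\<^sup>2 * (Re w)\<^sup>2 + (Im w)\<^sup>2) - t\<^sup>2 < 0) (at_left c)"
    using w by (rule order_tendstoD)
  then obtain e where e: "e < c" "\<And>t. e < t \<Longrightarrow> t < c \<Longrightarrow>
      (1 - t\<^sup>2) * (t\<^sup>2 * (Re w)\<^sup>2 + (Im w)\<^sup>2) - t\<^sup>2 < 0"
    using c by (auto simp: eventually_at_left[OF c(1)])
  then obtain u v where uv: "u \<in> H" "v \<in> H" "T u = u" "T v = (\<lambda>z. - v z)" 
      "nsq u \<noteq> 0" "nsq v \<noteq> 0" "max 0 e * sqrt (nsq u * nsq v) < cmod (ip u v)"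
    using sharp[of "max 0 e"] c by auto
  define m where "m = ip u v"
  define t where "t = cmod m / sqrt (nsq u * nsq v)"
  have pos: "0 < nsq u" "0 < nsq v" using uv nsq_nonneg by (simp_all add: less_le)
  have "0 < sqrt (nsq u * nsq v)" using pos by simp
  then have t: "max 0 e < t" unfolding t_def m_def using uv(7) by (rule pos_less_divide_eq[THEN iffD2])
  have "cmod m < c * sqrt (nsq u * nsq v)"
    by (rule power2_less_imp_less) (use angle[OF uv(1-6)] pos c in \<open>auto simp: m_def power_mult_distrib\<close>)
  then have tc: "t < c" using pos by (simp add: t_def pos_divide_less_eq)
  have "(1 - t\<^sup>2) * (t\<^sup>2 * (Re w)\<^sup>2 + (Im w)\<^sup>2) \<le> t\<^sup>2" using e(2)[of t] t tc by simp
  moreover have "0 < t" "t < 1" using t tc c by simp_all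
  ultimately obtain p q R J where pq: "0 \<le> p" "0 \<le> q" "p + q + 2 * t * R = 1" "p - q = Re w"
      "2 * t * J = Im w" "R\<^sup>2 + J\<^sup>2 = p * q"
    using ellipse_parametrisation[of t "Re w" "Im w"] by blast
  have "(cmod (Complex R J))\<^sup>2 = p * q" using pq(6) by (simp add: cmod_power2)
  then obtain x y where xy: "(cmod x)\<^sup>2 = p" "(cmod y)\<^sup>2 = q" "x * cnj y = Complex R J"
    using complex_pair_with_product[OF pq(1,2)] by blast
  \<comment> \<open>the factor \<open>sgn m\<close> rotates \<open>v\<close> so that its inner product with \<open>u\<close> becomes positive\<close>
  define \<alpha> \<beta> where "\<alpha> = x / of_real (sqrt (nsq u))" and "\<beta> = y * sgn m / of_real (sqrt (nsq v))"
  have m0: "m \<noteq> 0" using \<open>0 < t\<close> by (auto simp: t_def)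
  have \<alpha>: "(cmod \<alpha>)\<^sup>2 * nsq u = p" 
    using pos xy by (simp add: \<alpha>_def norm_divide power_divide)
  have \<beta>: "(cmod \<beta>)\<^sup>2 * nsq v = q"
    using pos xy m0 by (simp add: \<beta>_def norm_divide norm_mult power_divide norm_sgn)
  have "cnj (sgn m) * m = cmod m"
    using m0 by (simp add: sgn_eq mult.commute complex_norm_square[symmetric] power2_eq_square)
  then have "\<alpha> * cnj \<beta> * m = x * cnj y * of_real t"
    using pos by (simp add: \<alpha>_def \<beta>_def t_def real_sqrt_mult algebra_simps)
  then have \<alpha>\<beta>: "\<alpha> * cnj \<beta> * ip u v = Complex (t * R) (t * J)"
    by (simp add: xy m_def complex_eq_iff)
  define f where "f = (\<lambda>z. \<alpha> * u z + \<beta> * v z)"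
  have fH: "f \<in> H" unfolding f_def by (intro lincomb_mem uv)
  have f1: "nsq f = 1" 
    unfolding f_def nsq_lincomb[OF uv(1,2)] \<alpha>\<beta> \<alpha> \<beta> using pq by simp
  have Tf: "T f = (\<lambda>z. \<alpha> * u z + (- \<beta>) * v z)"
    unfolding f_def by (subst Tlin) (simp_all add: uv)
  have "ip (T f) f = of_real p - of_real q + (\<alpha> * cnj \<beta> * ip u v - cnj (\<alpha> * cnj \<beta> * ip u v))"
    unfolding Tf unfolding f_def ip_lincomb_both[OF uv(1,2)] \<alpha>[symmetric] \<beta>[symmetric]
    by (simp add: complex_norm_square[symmetric] algebra_simps)
  also have "\<dots> = w" unfolding \<alpha>\<beta> using pq(4,5) by (simp add: complex_eq_iff algebra_simps)
  finally have "w = ip (T f) f" ..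
  then show "w \<in> numerical_range H ip T"
    unfolding numerical_range_def using fH f1[unfolded nsq_def] by (intro CollectI exI[of _ f]) simp
qed

end

section \<open>The Hardy space as an inner product space\<close>

definition has_coeffs :: "(complex \<Rightarrow> complex) \<Rightarrow> (nat \<Rightarrow> complex) \<Rightarrow> bool" where
  "has_coeffs f a \<longleftrightarrow> (\<forall>z\<in>unit_disk. (\<lambda>n. a n * z ^ n) sums f z)"

definition circle_mean :: "real \<Rightarrow> (complex \<Rightarrow> complex) \<Rightarrow> (complex \<Rightarrow> complex) \<Rightarrow> complex" where
  "circle_mean r f g =
     integral {0..2*pi} (\<lambda>\<theta>. f (of_real r * cis \<theta>) * cnj (g (of_real r * cis \<theta>))) / of_real (2*pi)"

definition mean_square :: "real \<Rightarrow> (complex \<Rightarrow> complex) \<Rightarrow> real" where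
  "mean_square r f = integral {0..2*pi} (\<lambda>\<theta>. (cmod (f (of_real r * cis \<theta>)))\<^sup>2) / (2*pi)"

lemma circle_in_disk: "0 \<le> r \<Longrightarrow> r < 1 \<Longrightarrow> of_real r * cis \<theta> \<in> unit_disk"
  by (simp add: norm_mult)

lemma has_integral_cis_mult:
  "((\<lambda>\<theta>. cis (real n * \<theta>) * cnj (cis (real m * \<theta>))) has_integral (if n = m then of_real (2*pi) else 0)) {0..2*pi}"
proof (cases "n = m")
  case True
  have "((\<lambda>\<theta>::real. 1::complex) has_integral of_real (2*pi)) {0..2*pi}"
    using has_integral_const_real[of "1::complex" 0 "2*pi"] by (simp add: scaleR_conv_of_real)
  then show ?thesis using True by (simp add: cis_cnj cis_mult)
next
  case False
  define k where "k = real n - real m"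
  have k: "k \<noteq> 0" using False by (simp add: k_def)
  define F where "F = (\<lambda>\<theta>::real. cis (k * \<theta>) / (\<i> * of_real k))"
  have "((\<lambda>\<theta>. cis (k * \<theta>)) has_integral (F (2*pi) - F 0)) {0..2*pi}"
  proof (rule fundamental_theorem_of_calculus)
    fix x :: real
    have "((\<lambda>z. exp (\<i> * (of_real k * z)) / (\<i> * of_real k)) has_field_derivative
        exp (\<i> * (of_real k * of_real x))) (at (of_real x))"
      using k by (auto intro!: derivative_eq_intros simp: mult.commute mult.left_commute)
    from has_vector_derivative_real_field[OF this]
    show "(F has_vector_derivative cis (k * x)) (at x within {0..2*pi})"
      by (simp add: F_def cis_conv_exp)
  qed simp
  moreover have "F (2*pi) = F 0"
  proof -
    have "cis (k * (2*pi)) = cis (2 * pi * real n) * cnj (cis (2 * pi * real m))"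
      by (simp add: k_def cis_cnj cis_mult algebra_simps)
    also have "\<dots> = 1" by (simp add: cis_multiple_2pi)
    finally show ?thesis by (simp add: F_def)
  qed
  ultimately show ?thesis using False by (simp add: k_def cis_cnj cis_mult left_diff_distrib)
qed

lemma has_coeffs_continuous: "has_coeffs f a \<Longrightarrow> continuous_on unit_disk f"
  unfolding has_coeffs_def
  by (intro holomorphic_on_imp_continuous_on power_series_holomorphic[where a = a]) simp

lemma has_coeffs_uniform_limit:
  assumes "has_coeffs f a" "r < 1"
  shows "uniform_limit (cball 0 r) (\<lambda>N z. \<Sum>n<N. a n * z ^ n) f sequentially"
proof -
  have "conv_radius a \<ge> 1"
  proof (rule conv_radius_geI_ex')
    fix r :: real assume "0 < r" "ereal r < 1"
    then show "summable (\<lambda>n. a n * of_real r ^ n)"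
      using assms(1) by (intro sums_summable[of _ "f (of_real r)"]) (simp add: has_coeffs_def)
  qed
  moreover have "ereal r < 1" using assms by simp
  ultimately have "ereal r < conv_radius a" by (rule less_le_trans[rotated])
  then have lim: "uniform_limit (cball 0 r) (\<lambda>N z. \<Sum>n<N. a n * (z - 0) ^ n) (\<lambda>z. \<Sum>n. a n * (z - 0) ^ n) sequentially"
    by (rule powser_uniform_limit)
  have eq: "(\<Sum>n. a n * (z - 0) ^ n) = f z" if "z \<in> cball 0 r" for z
    using assms that by (intro sums_unique[symmetric]) (simp add: has_coeffs_def)
  show ?thesis
    by (rule uniform_limit_cong'[THEN iffD1, OF _ _ lim]) (simp, rule eq)
qed

lemma has_coeffs_uniform_limit_circle:
  assumes "has_coeffs f a" "0 \<le> r" "r < 1"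
  shows "uniform_limit {0..2*pi} (\<lambda>N \<theta>. \<Sum>n<N. a n * (of_real r * cis \<theta>) ^ n)
    (\<lambda>\<theta>. f (of_real r * cis \<theta>)) sequentially"
  by (rule uniform_limit_compose'[OF has_coeffs_uniform_limit[OF assms(1,3)]])
     (use assms in \<open>auto simp: norm_mult\<close>)

lemma continuous_on_circle:
  assumes "continuous_on unit_disk f" "0 \<le> r" "r < 1"
  shows "continuous_on {0..2*pi} (\<lambda>\<theta>. f (of_real r * cis \<theta>))"
  by (rule continuous_on_compose2[OF assms(1)])
     (use assms circle_in_disk in \<open>auto intro!: continuous_intros\<close>)

text \<open>
  Partial sums converge uniformly on a circle inside the disk, so the integral can be computed for
  trigonometric polynomials, where orthogonality leaves the diagonal terms only.
\<close>
theorem parseval_sums: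
  assumes f: "has_coeffs f a" and g: "has_coeffs g b" and r: "0 \<le> r" "r < 1"
  shows "(\<lambda>n. a n * cnj (b n) * of_real (r ^ (2 * n))) sums circle_mean r f g"
proof -
  define S where "S a N \<theta> = (\<Sum>n<N. a n * (of_real r * cis \<theta>) ^ n)" for a :: "nat \<Rightarrow> complex" and N \<theta>
  define I where "I = (\<lambda>N. \<Sum>n<N. a n * cnj (b n) * of_real (r ^ (2 * n)) * of_real (2*pi))"
  have bdd: "bounded ((\<lambda>\<theta>. h (of_real r * cis \<theta>)) ` {0..2*pi})" if "has_coeffs h d" for h d
    using continuous_on_circle[OF has_coeffs_continuous[OF that] r]
    by (intro compact_imp_bounded compact_continuous_image) auto
  have uf: "uniform_limit {0..2*pi} (S a) (\<lambda>\<theta>. f (of_real r * cis \<theta>)) sequentially"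
    using has_coeffs_uniform_limit_circle[OF f r] by (simp add: S_def[abs_def])
  have ug: "uniform_limit {0..2*pi} (\<lambda>N \<theta>. cnj (S b N \<theta>)) (\<lambda>\<theta>. cnj (g (of_real r * cis \<theta>))) sequentially"
    using bounded_linear.uniform_limit[OF bounded_linear_cnj has_coeffs_uniform_limit_circle[OF g r]] by (simp add: S_def[abs_def])
  have bdd_cnj: "bounded ((\<lambda>\<theta>. cnj (g (of_real r * cis \<theta>))) ` {0..2*pi})"
    using bdd[OF g] by (auto simp: bounded_iff)
  have u: "uniform_limit {0..2*pi} (\<lambda>N \<theta>. S a N \<theta> * cnj (S b N \<theta>))
      (\<lambda>\<theta>. f (of_real r * cis \<theta>) * cnj (g (of_real r * cis \<theta>))) sequentially"
    by (rule uniform_lim_mult[OF uf ug bdd[OF f] bdd_cnj])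
  have I: "((\<lambda>\<theta>. S a N \<theta> * cnj (S b N \<theta>)) has_integral I N) {0..2*pi}" for N
  proof -
    have cis_power: "cis (real n * \<theta>) = cis \<theta> ^ n" for n \<theta> by (rule Complex.DeMoivre[symmetric])
    have "S a N \<theta> * cnj (S b N \<theta>) = (\<Sum>n<N. \<Sum>m<N. a n * cnj (b m) * of_real (r ^ (n + m)) *
         (cis (real n * \<theta>) * cnj (cis (real m * \<theta>))))" for \<theta>
      unfolding S_def cnj_sum sum_product
      by (intro sum.cong refl) (simp only: cis_power, simp only: power_mult_distrib power_add complex_cnj_mult complex_cnj_power complex_cnj_complex_of_real of_real_power of_real_mult mult_ac)
    moreover have "((\<lambda>\<theta>. \<Sum>n<N. \<Sum>m<N. a n * cnj (b m) * of_real (r ^ (n + m)) *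
         (cis (real n * \<theta>) * cnj (cis (real m * \<theta>)))) has_integral
         (\<Sum>n<N. \<Sum>m<N. a n * cnj (b m) * of_real (r ^ (n + m)) * (if n = m then of_real (2*pi) else 0))) {0..2*pi}"
      by (intro has_integral_sum has_integral_mult_right has_integral_cis_mult) auto
    moreover have "(\<Sum>n<N. \<Sum>m<N. a n * cnj (b m) * of_real (r ^ (n + m)) * (if n = m then of_real (2*pi) else 0)) = I N"
      unfolding I_def
    proof (rule sum.cong[OF refl])
      fix n assume "n \<in> {..<N}"
      then have "(\<Sum>m<N. F m * (if n = m then t else 0)) = F n * t" for F and t :: complex
        by (subst sum.remove[of _ n]) (auto intro!: sum.neutral)
      then show "(\<Sum>m<N. a n * cnj (b m) * of_real (r ^ (n + m)) * (if n = m then of_real (2*pi) else 0)) =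
          a n * cnj (b n) * of_real (r ^ (2 * n)) * of_real (2*pi)"
        unfolding mult_2[of n] .
    qed
    ultimately show ?thesis by simp
  qed
  have c: "continuous_on {0..2*pi} (\<lambda>\<theta>. S a N \<theta> * cnj (S b N \<theta>))" for N
    unfolding S_def by (intro continuous_intros)
  obtain I' J where "\<And>N. ((\<lambda>\<theta>. S a N \<theta> * cnj (S b N \<theta>)) has_integral I' N) {0..2*pi}"
    and J: "((\<lambda>\<theta>. f (of_real r * cis \<theta>) * cnj (g (of_real r * cis \<theta>))) has_integral J) {0..2*pi}"
    and lim: "I' \<longlonglongrightarrow> J"
    using uniform_limit_integral[OF u c] by auto
  then have "I' = I" using I has_integral_unique by blast
  then have "(\<lambda>n. a n * cnj (b n) * of_real (r ^ (2 * n)) * of_real (2*pi)) sums J"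
    using lim by (simp add: sums_def I_def)
  then have "(\<lambda>n. a n * cnj (b n) * of_real (r ^ (2 * n)) * of_real (2*pi) / of_real (2*pi)) sums (J / of_real (2*pi))"
    by (rule sums_divide)
  then show ?thesis using J by (simp add: circle_mean_def integral_unique)
qed

lemma circle_mean_self:
  assumes "continuous_on unit_disk f" "0 \<le> r" "r < 1"
  shows "circle_mean r f f = of_real (mean_square r f)"
proof -
  have "((\<lambda>\<theta>. (cmod (f (of_real r * cis \<theta>)))\<^sup>2) has_integral (2 * pi * mean_square r f)) {0..2*pi}"
  proof -
    have "(\<lambda>\<theta>. (cmod (f (of_real r * cis \<theta>)))\<^sup>2) integrable_on {0..2*pi}"
      by (intro integrable_continuous_interval continuous_intros continuous_on_circle assms)
    then show ?thesis by (simp add: mean_square_def integrable_integral)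
  qed
  from has_integral_of_real[OF this, where 'b = complex]
  have "integral {0..2*pi} (\<lambda>\<theta>. f (of_real r * cis \<theta>) * cnj (f (of_real r * cis \<theta>))) =
      of_real (2 * pi * mean_square r f)"
    unfolding complex_norm_square by (rule integral_unique)
  then show ?thesis unfolding circle_mean_def by simp
qed

lemma mean_square_sums:
  assumes f: "has_coeffs f a" and r: "0 \<le> r" "r < 1"
  shows "(\<lambda>n. (cmod (a n))\<^sup>2 * r ^ (2 * n)) sums mean_square r f"
proof -
  have "(\<lambda>n. of_real ((cmod (a n))\<^sup>2 * r ^ (2 * n)) :: complex) sums of_real (mean_square r f)"
    using parseval_sums[OF f f r]
    unfolding circle_mean_self[OF has_coeffs_continuous[OF f] r] complex_norm_square[symmetric]
      of_real_mult[symmetric] .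
  then show ?thesis unfolding sums_of_real_iff .
qed

text \<open>
  For absolutely summable coefficients Abel's theorem is dominated convergence for series.
\<close>
lemma tendsto_at_left_power_series:
  fixes c :: "nat \<Rightarrow> complex"
  assumes "summable (\<lambda>n. cmod (c n))"
  shows "((\<lambda>r. \<Sum>n. c n * of_real (r ^ (2 * n))) \<longlongrightarrow> (\<Sum>n. c n)) (at_left (1::real))"
proof -
  have "((\<lambda>r. \<Sum>n. c n * of_real (r ^ (2 * n))) \<longlongrightarrow> (\<Sum>n. c n * of_real (1 ^ (2 * n)))) (at_left (1::real))"
  proof (rule tannerys_theorem[THEN conjunct2, THEN conjunct2])
    show "((\<lambda>r. c k * of_real (r ^ (2 * k))) \<longlongrightarrow> c k * of_real (1 ^ (2 * k))) (at_left (1::real))" for k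
      by (intro tendsto_intros)
    have "eventually (\<lambda>r::real. r \<in> {0<..<1}) (at_left 1)"
      by (rule eventually_at_leftI[of 0]) auto
    with eventually_True have "\<forall>\<^sub>F x in sequentially \<times>\<^sub>F at_left (1::real). True \<and> snd x \<in> {0<..<1}"
      by (rule eventually_prodI)
    then show "\<forall>\<^sub>F (k, r) in sequentially \<times>\<^sub>F at_left (1::real). cmod (c k * of_real (r ^ (2 * k))) \<le> cmod (c k)"
    proof (rule eventually_mono)
      fix x :: "nat \<times> real" assume "True \<and> snd x \<in> {0<..<1}"
      then obtain k r where x: "x = (k, r)" "0 < r" "r < 1" by (cases x) auto
      then have "cmod (c k) * r ^ (2 * k) \<le> cmod (c k) * 1"
        by (intro mult_left_mono power_le_one) auto
      then show "case x of (k, r) \<Rightarrow> cmod (c k * of_real (r ^ (2 * k))) \<le> cmod (c k)"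
        using x by (simp add: norm_mult norm_power)
    qed
  qed (use assms in simp_all)
  then show ?thesis by (simp only: power_one of_real_1 mult_1_right)
qed

definition square_summable :: "(nat \<Rightarrow> complex) \<Rightarrow> bool" where
  "square_summable a \<longleftrightarrow> summable (\<lambda>n. (cmod (a n))\<^sup>2)"

lemma square_summable_mult:
  assumes "square_summable a" "square_summable b"
  shows "summable (\<lambda>n. cmod (a n * cnj (b n)))"
proof (rule summable_comparison_test')
  show "summable (\<lambda>n. (cmod (a n))\<^sup>2 + (cmod (b n))\<^sup>2)"
    using assms by (intro summable_add) (simp_all add: square_summable_def)
  show "norm (cmod (a n * cnj (b n))) \<le> (cmod (a n))\<^sup>2 + (cmod (b n))\<^sup>2" for n
  proof -
    have "0 \<le> cmod (a n) * cmod (b n)" by simp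
    then show ?thesis
      using sum_squares_bound[of "cmod (a n)" "cmod (b n)"]
      unfolding norm_mult complex_mod_cnj abs_norm_cancel real_norm_def abs_mult mult.assoc by linarith
  qed
qed

lemma hardy_spaceI:
  assumes "f holomorphic_on unit_disk" "\<And>z. z \<notin> unit_disk \<Longrightarrow> f z = 0"
    and "\<And>r. 0 \<le> r \<Longrightarrow> r < 1 \<Longrightarrow> mean_square r f \<le> B"
  shows "f \<in> hardy_space"
  using assms by (auto simp: hardy_space_def mean_square_def intro!: bdd_aboveI2[where M = B])

lemma hardy_spaceD:
  assumes "f \<in> hardy_space"
  shows "f holomorphic_on unit_disk" "z \<notin> unit_disk \<Longrightarrow> f z = 0"
  using assms by (auto simp: hardy_space_def)

text \<open>
  Finite partial sums of \<open>|a\<^sub>n|\<^sup>2\<close> are limits of the partial sums of \<open>|a\<^sub>n|\<^sup>2 r\<^bsup>2n\<^esup>\<close>, which are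
  bounded by the circle means.
\<close>
lemma hardy_space_coeffs:
  assumes "f \<in> hardy_space"
  obtains a where "has_coeffs f a" "square_summable a"
proof -
  define a where "a = (\<lambda>n. (deriv ^^ n) f 0 / fact n)"
  have a: "has_coeffs f a"
    unfolding has_coeffs_def a_def
    using holomorphic_power_series[OF hardy_spaceD(1)[OF assms]] by simp
  from assms obtain B where "\<forall>r\<in>{0..<1}. mean_square r f \<le> B"
    by (auto simp: hardy_space_def mean_square_def bdd_above_def)
  then have B: "mean_square r f \<le> B" if "0 \<le> r" "r < 1" for r using that by simp
  have "square_summable a"
    unfolding square_summable_def
  proof (rule bounded_imp_summable)
    fix N
    have "((\<lambda>r::real. \<Sum>n\<le>N. (cmod (a n))\<^sup>2 * r ^ (2 * n)) \<longlongrightarrow> (\<Sum>n\<le>N. (cmod (a n))\<^sup>2 * 1 ^ (2 * n))) (at_left 1)"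
      by (intro tendsto_intros)
    moreover have "eventually (\<lambda>r. (\<Sum>n\<le>N. (cmod (a n))\<^sup>2 * r ^ (2 * n)) \<le> B) (at_left (1::real))"
    proof (rule eventually_at_leftI[of 0])
      fix r :: real assume r: "r \<in> {0<..<1}"
      note s = mean_square_sums[OF a, of r]
      have "(\<Sum>n\<le>N. (cmod (a n))\<^sup>2 * r ^ (2 * n)) \<le> mean_square r f"
        using r s by (subst sums_unique[OF s]) (auto intro!: sum_le_suminf dest: sums_summable)
      with B[of r] r show "(\<Sum>n\<le>N. (cmod (a n))\<^sup>2 * r ^ (2 * n)) \<le> B" by simp
    qed simp
    ultimately have "(\<Sum>n\<le>N. (cmod (a n))\<^sup>2 * 1 ^ (2 * n)) \<le> B"
      by (rule tendsto_upperbound) simp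
    then show "(\<Sum>n\<le>N. (cmod (a n))\<^sup>2) \<le> B" by simp
  qed simp
  with a that show ?thesis by blast
qed

lemma hardy_space_coeffsI:
  assumes f: "has_coeffs f a" and a: "square_summable a" and 0: "\<And>z. z \<notin> unit_disk \<Longrightarrow> f z = 0"
  shows "f \<in> hardy_space"
proof (rule hardy_spaceI)
  show "f holomorphic_on unit_disk"
    using f unfolding has_coeffs_def by (intro power_series_holomorphic[where a = a]) simp
  show "mean_square r f \<le> (\<Sum>n. (cmod (a n))\<^sup>2)" if "0 \<le> r" "r < 1" for r
  proof (rule sums_le[OF _ mean_square_sums[OF f that] summable_sums])
    show "(cmod (a n))\<^sup>2 * r ^ (2 * n) \<le> (cmod (a n))\<^sup>2" for n
      using that by (intro mult_left_le power_le_one) auto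
  qed (use a in \<open>simp add: square_summable_def\<close>)
qed (use 0 in simp)

lemma circle_mean_tendsto:
  assumes "has_coeffs f a" "square_summable a" "has_coeffs g b" "square_summable b"
  shows "((\<lambda>r. circle_mean r f g) \<longlongrightarrow> (\<Sum>n. a n * cnj (b n))) (at_left 1)"
proof (rule Lim_transform_eventually)
  show "((\<lambda>r. \<Sum>n. a n * cnj (b n) * of_real (r ^ (2 * n))) \<longlongrightarrow> (\<Sum>n. a n * cnj (b n))) (at_left 1)"
    by (intro tendsto_at_left_power_series square_summable_mult assms)
  show "\<forall>\<^sub>F r in at_left 1. (\<Sum>n. a n * cnj (b n) * of_real (r ^ (2 * n))) = circle_mean r f g"
    by (rule eventually_at_leftI[of 0], rule sums_unique[symmetric], rule parseval_sums[OF assms(1,3)]) simp_all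
qed

text \<open>
  This identifies the limit in the definition of the inner product with the inner product of \<open>\<ell>\<^sup>2\<close>;
  all algebraic properties of the inner product are derived from it.
\<close>
lemma hardy_inner_sums:
  assumes "has_coeffs f a" "square_summable a" "has_coeffs g b" "square_summable b"
  shows "(\<lambda>n. a n * cnj (b n)) sums hardy_inner f g"
proof -
  have "hardy_inner f g = (\<Sum>n. a n * cnj (b n))"
    unfolding hardy_inner_def circle_mean_def[symmetric]
    by (rule tendsto_Lim[OF _ circle_mean_tendsto[OF assms]]) simp
  moreover have "summable (\<lambda>n. a n * cnj (b n))"
    by (rule summable_norm_cancel) (rule square_summable_mult[OF assms(2,4)])
  ultimately show ?thesis by (simp add: summable_sums)
qed

lemma has_coeffs_lincomb:
  "has_coeffs f a \<Longrightarrow> has_coeffs g b \<Longrightarrow> has_coeffs (\<lambda>z. x * f z + y * g z) (\<lambda>n. x * a n + y * b n)"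
  unfolding has_coeffs_def
  by (intro ballI, drule (1) bspec, drule (1) bspec, drule sums_mult[of _ _ y], drule sums_mult[of "\<lambda>n. a n * _ ^ n" _ x],
      drule (1) sums_add) (simp add: algebra_simps)

lemma square_summable_lincomb:
  assumes "square_summable a" "square_summable b"
  shows "square_summable (\<lambda>n. x * a n + y * b n)"
  unfolding square_summable_def
proof (rule summable_comparison_test')
  show "summable (\<lambda>n. 2 * (cmod x)\<^sup>2 * (cmod (a n))\<^sup>2 + 2 * (cmod y)\<^sup>2 * (cmod (b n))\<^sup>2)"
    using assms by (intro summable_add summable_mult) (simp_all add: square_summable_def)
  show "norm ((cmod (x * a n + y * b n))\<^sup>2) \<le> 2 * (cmod x)\<^sup>2 * (cmod (a n))\<^sup>2 + 2 * (cmod y)\<^sup>2 * (cmod (b n))\<^sup>2" for n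
  proof -
    have "(cmod (x * a n + y * b n))\<^sup>2 \<le> (cmod (x * a n) + cmod (y * b n))\<^sup>2"
      by (intro power_mono norm_triangle_ineq) simp
    also have "\<dots> \<le> 2 * (cmod (x * a n))\<^sup>2 + 2 * (cmod (y * b n))\<^sup>2"
      using sum_squares_bound[of "cmod (x * a n)" "cmod (y * b n)"] by (simp add: power2_sum)
    finally show ?thesis by (simp add: norm_mult power_mult_distrib)
  qed
qed

lemma hardy_nsq_sums:
  assumes "has_coeffs f a" "square_summable a"
  shows "(\<lambda>n. (cmod (a n))\<^sup>2) sums Re (hardy_inner f f)"
proof -
  have "(\<lambda>n. a n * cnj (a n)) sums hardy_inner f f"
    by (rule hardy_inner_sums[OF assms assms])
  from sums_Re[OF this] show ?thesis by (simp only: complex_norm_square[symmetric] Re_complex_of_real)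
qed

lemma hardy_space_lincomb:
  assumes f: "f \<in> hardy_space" and g: "g \<in> hardy_space"
  shows "(\<lambda>z. x * f z + y * g z) \<in> hardy_space"
proof -
  obtain a where a: "has_coeffs f a" "square_summable a" using f by (rule hardy_space_coeffs)
  obtain b where b: "has_coeffs g b" "square_summable b" using g by (rule hardy_space_coeffs)
  show ?thesis
    by (rule hardy_space_coeffsI[OF has_coeffs_lincomb[OF a(1) b(1)] square_summable_lincomb[OF a(2) b(2)]])
       (simp add: hardy_spaceD(2)[OF f] hardy_spaceD(2)[OF g])
qed

lemma hardy_inner_cnj:
  assumes f: "f \<in> hardy_space" and g: "g \<in> hardy_space"
  shows "hardy_inner g f = cnj (hardy_inner f g)"
proof -
  obtain a where a: "has_coeffs f a" "square_summable a" using f by (rule hardy_space_coeffs)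
  obtain b where b: "has_coeffs g b" "square_summable b" using g by (rule hardy_space_coeffs)
  show ?thesis
  proof (rule sums_unique2[OF hardy_inner_sums[OF b a]])
    have "(\<lambda>n. cnj (a n * cnj (b n))) sums cnj (hardy_inner f g)"
      using hardy_inner_sums[OF a b] by (simp only: sums_cnj)
    then show "(\<lambda>n. b n * cnj (a n)) sums cnj (hardy_inner f g)" by (simp add: mult.commute)
  qed
qed

lemma hardy_inner_lincomb:
  assumes f: "f \<in> hardy_space" and g: "g \<in> hardy_space" and h: "h \<in> hardy_space"
  shows "hardy_inner (\<lambda>z. x * f z + y * g z) h = x * hardy_inner f h + y * hardy_inner g h"
proof -
  obtain a where a: "has_coeffs f a" "square_summable a" using f by (rule hardy_space_coeffs)
  obtain b where b: "has_coeffs g b" "square_summable b" using g by (rule hardy_space_coeffs)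
  obtain d where d: "has_coeffs h d" "square_summable d" using h by (rule hardy_space_coeffs)
  show ?thesis
  proof (rule sums_unique2[OF hardy_inner_sums])
    show "has_coeffs (\<lambda>z. x * f z + y * g z) (\<lambda>n. x * a n + y * b n)"
      by (rule has_coeffs_lincomb[OF a(1) b(1)])
    show "square_summable (\<lambda>n. x * a n + y * b n)"
      by (rule square_summable_lincomb[OF a(2) b(2)])
    have "(\<lambda>n. x * (a n * cnj (d n)) + y * (b n * cnj (d n))) sums (x * hardy_inner f h + y * hardy_inner g h)"
      by (intro sums_add sums_mult hardy_inner_sums[OF a d] hardy_inner_sums[OF b d])
    then show "(\<lambda>n. (x * a n + y * b n) * cnj (d n)) sums (x * hardy_inner f h + y * hardy_inner g h)"
      by (simp only: distrib_right mult.assoc)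
  qed (use d in auto)
qed

lemma hardy_inner_definite:
  assumes f: "f \<in> hardy_space" and 0: "Re (hardy_inner f f) = 0"
  shows "f = (\<lambda>z. 0)"
proof -
  obtain a where a: "has_coeffs f a" "square_summable a" using f by (rule hardy_space_coeffs)
  have s0: "(\<lambda>n. (cmod (a n))\<^sup>2) sums 0" using hardy_nsq_sums[OF a] unfolding 0 .
  have "\<forall>n. (cmod (a n))\<^sup>2 = 0"
    by (rule suminf_eq_zero_iff[OF sums_summable[OF s0], THEN iffD1]) (simp_all add: sums_unique[OF s0, symmetric])
  then have a0: "a n = 0" for n by simp
  have "f z = 0" for z
  proof (cases "z \<in> unit_disk")
    case True
    then have "(\<lambda>n. a n * z ^ n) sums f z" using a by (simp add: has_coeffs_def)
    moreover have "(\<lambda>n. a n * z ^ n) sums 0" by (simp add: a0)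
    ultimately show ?thesis by (rule sums_unique2)
  next
    case False
    then show ?thesis by (rule hardy_spaceD(2)[OF f])
  qed
  then show ?thesis by blast
qed

lemma hardy_inner_nonneg:
  assumes "f \<in> hardy_space"
  shows "0 \<le> Re (hardy_inner f f)"
proof -
  obtain a where a: "has_coeffs f a" "square_summable a" using assms by (rule hardy_space_coeffs)
  show ?thesis by (rule sums_le[OF _ sums_zero hardy_nsq_sums[OF a]]) simp
qed

interpretation hardy: function_inner_product hardy_space hardy_inner
  by (rule function_inner_product.intro)
     (fact hardy_space_lincomb hardy_inner_lincomb hardy_inner_cnj hardy_inner_nonneg hardy_inner_definite)+

section \<open>Multiplication operators, the Szego kernel and polynomials\<close>

lemma hardy_continuous: "f \<in> hardy_space \<Longrightarrow> continuous_on unit_disk f"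
  by (rule holomorphic_on_imp_continuous_on[OF hardy_spaceD(1)])

lemma mean_square_tendsto:
  assumes "f \<in> hardy_space"
  shows "((\<lambda>r. mean_square r f) \<longlongrightarrow> hardy.nsq f) (at_left 1)"
proof -
  obtain a where a: "has_coeffs f a" "square_summable a" using assms by (rule hardy_space_coeffs)
  have "((\<lambda>r. Re (circle_mean r f f)) \<longlongrightarrow> hardy.nsq f) (at_left 1)"
    unfolding hardy.nsq_def sums_unique[OF hardy_inner_sums[OF a a]]
    by (intro tendsto_Re circle_mean_tendsto a)
  moreover have "\<forall>\<^sub>F r in at_left 1. Re (circle_mean r f f) = mean_square r f"
    by (rule eventually_at_leftI[of 0]) (simp_all add: circle_mean_self[OF hardy_continuous[OF assms]])
  ultimately show ?thesis by (rule Lim_transform_eventually)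
qed

lemma mean_square_le_nsq:
  assumes "f \<in> hardy_space" "0 \<le> r" "r < 1"
  shows "mean_square r f \<le> hardy.nsq f"
proof -
  obtain a where a: "has_coeffs f a" "square_summable a" using assms(1) by (rule hardy_space_coeffs)
  show ?thesis
    unfolding hardy.nsq_def
  proof (rule sums_le[OF _ mean_square_sums[OF a(1) assms(2,3)] hardy_nsq_sums[OF a]])
    show "(cmod (a n))\<^sup>2 * r ^ (2 * n) \<le> (cmod (a n))\<^sup>2" for n
      using assms by (intro mult_left_le power_le_one) auto
  qed
qed

text \<open>
  The quantitative membership criterion: a uniform bound for the circle means bounds the norm, since the
  norm is their limit. It serves for functions that are only known as locally uniform limits.
\<close>
lemma hardy_spaceI_nsq:
  assumes "f holomorphic_on unit_disk" "\<And>z. z \<notin> unit_disk \<Longrightarrow> f z = 0"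
    and B: "\<And>r. 0 \<le> r \<Longrightarrow> r < 1 \<Longrightarrow> mean_square r f \<le> B"
  shows "f \<in> hardy_space" "hardy.nsq f \<le> B"
proof -
  show f: "f \<in> hardy_space" by (rule hardy_spaceI[OF assms])
  show "hardy.nsq f \<le> B"
  proof (rule tendsto_upperbound[OF mean_square_tendsto[OF f]])
    show "\<forall>\<^sub>F r in at_left 1. mean_square r f \<le> B"
      by (rule eventually_at_leftI[of 0]) (simp_all add: B)
  qed simp
qed

lemma mean_square_mono:
  assumes f: "continuous_on unit_disk f" and g: "continuous_on unit_disk g"
    and r: "0 \<le> r" "r < 1"
    and le: "\<And>z. cmod z = r \<Longrightarrow> \<alpha> * (cmod (f z))\<^sup>2 \<le> \<beta> * (cmod (g z))\<^sup>2"
  shows "\<alpha> * mean_square r f \<le> \<beta> * mean_square r g"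
proof -
  have "integral {0..2*pi} (\<lambda>\<theta>. \<alpha> * (cmod (f (of_real r * cis \<theta>)))\<^sup>2) \<le>
      integral {0..2*pi} (\<lambda>\<theta>. \<beta> * (cmod (g (of_real r * cis \<theta>)))\<^sup>2)"
  proof (rule integral_le)
    show "(\<lambda>\<theta>. \<alpha> * (cmod (f (of_real r * cis \<theta>)))\<^sup>2) integrable_on {0..2*pi}"
      by (intro integrable_continuous_interval continuous_intros continuous_on_circle f r)
    show "(\<lambda>\<theta>. \<beta> * (cmod (g (of_real r * cis \<theta>)))\<^sup>2) integrable_on {0..2*pi}"
      by (intro integrable_continuous_interval continuous_intros continuous_on_circle g r)
    show "\<alpha> * (cmod (f (of_real r * cis \<theta>)))\<^sup>2 \<le> \<beta> * (cmod (g (of_real r * cis \<theta>)))\<^sup>2" for \<theta>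
      using r by (intro le) (simp add: norm_mult)
  qed
  then have "\<alpha> * integral {0..2*pi} (\<lambda>\<theta>. (cmod (f (of_real r * cis \<theta>)))\<^sup>2) / (2*pi) \<le>
      \<beta> * integral {0..2*pi} (\<lambda>\<theta>. (cmod (g (of_real r * cis \<theta>)))\<^sup>2) / (2*pi)"
    by (intro divide_right_mono) simp_all
  then show ?thesis unfolding mean_square_def by simp
qed

lemma hardy_mult_bounded:
  assumes f: "f \<in> hardy_space" and g: "g holomorphic_on unit_disk"
    and K: "\<And>z. z \<in> unit_disk \<Longrightarrow> cmod (g z) \<le> K"
  shows "(\<lambda>z. g z * f z) \<in> hardy_space" "hardy.nsq (\<lambda>z. g z * f z) \<le> K\<^sup>2 * hardy.nsq f"
proof -
  have hol: "(\<lambda>z. g z * f z) holomorphic_on unit_disk"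
    by (intro holomorphic_intros g hardy_spaceD(1)[OF f])
  have 0: "g z * f z = 0" if "z \<notin> unit_disk" for z
    using hardy_spaceD(2)[OF f that] by simp
  have B: "mean_square r (\<lambda>z. g z * f z) \<le> K\<^sup>2 * hardy.nsq f" if r: "0 \<le> r" "r < 1" for r
  proof -
    have "1 * mean_square r (\<lambda>z. g z * f z) \<le> K\<^sup>2 * mean_square r f"
    proof (rule mean_square_mono[OF holomorphic_on_imp_continuous_on[OF hol] hardy_continuous[OF f] r])
      fix z :: complex assume "cmod z = r"
      then have "(cmod (g z))\<^sup>2 \<le> K\<^sup>2" using r by (intro power_mono K) simp_all
      then show "1 * (cmod (g z * f z))\<^sup>2 \<le> K\<^sup>2 * (cmod (f z))\<^sup>2"
        by (simp add: norm_mult power_mult_distrib mult_right_mono)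
    qed
    also have "\<dots> \<le> K\<^sup>2 * hardy.nsq f"
      by (intro mult_left_mono mean_square_le_nsq f r) simp
    finally show ?thesis by simp
  qed
  show "(\<lambda>z. g z * f z) \<in> hardy_space" "hardy.nsq (\<lambda>z. g z * f z) \<le> K\<^sup>2 * hardy.nsq f"
    by (rule hardy_spaceI_nsq[OF hol 0 B]; simp)+
qed

text \<open>
  A bounded function whose modulus tends to \<open>1\<close> at the boundary, at the rate of \<open>1 - |z|\<^sup>2\<close>, acts
  isometrically: the circle means of \<open>f\<close> and \<open>\<psi> f\<close> differ by at most \<open>K (1 - r\<^sup>2) |f|\<^sup>2\<close>.
\<close>
lemma hardy_mult_inner_function:
  assumes f: "f \<in> hardy_space" and \<psi>: "\<psi> holomorphic_on unit_disk"
    and le1: "\<And>z. z \<in> unit_disk \<Longrightarrow> cmod (\<psi> z) \<le> 1"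
    and ge: "\<And>z. z \<in> unit_disk \<Longrightarrow> 1 - (cmod (\<psi> z))\<^sup>2 \<le> K * (1 - (cmod z)\<^sup>2)"
  shows "(\<lambda>z. \<psi> z * f z) \<in> hardy_space" "hardy.nsq (\<lambda>z. \<psi> z * f z) = hardy.nsq f"
proof -
  show H: "(\<lambda>z. \<psi> z * f z) \<in> hardy_space"
    by (rule hardy_mult_bounded[OF f \<psi> le1])
  have "((\<lambda>r::real. (1 - K * (1 - r\<^sup>2)) * mean_square r f) \<longlongrightarrow> (1 - K * (1 - 1\<^sup>2)) * hardy.nsq f) (at_left 1)"
    by (intro tendsto_intros mean_square_tendsto f)
  moreover have "\<forall>\<^sub>F r in at_left 1. (1 - K * (1 - r\<^sup>2)) * mean_square r f \<le> mean_square r (\<lambda>z. \<psi> z * f z)"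
  proof (rule eventually_at_leftI[of 0])
    fix r :: real assume "r \<in> {0<..<1}"
    then have r: "0 \<le> r" "r < 1" by simp_all
    have "(1 - K * (1 - r\<^sup>2)) * mean_square r f \<le> 1 * mean_square r (\<lambda>z. \<psi> z * f z)"
    proof (rule mean_square_mono[OF hardy_continuous[OF f] hardy_continuous[OF H] r])
      fix z :: complex assume z: "cmod z = r"
      then have "1 - K * (1 - r\<^sup>2) \<le> (cmod (\<psi> z))\<^sup>2" using ge[of z] r by simp
      then have "(1 - K * (1 - r\<^sup>2)) * (cmod (f z))\<^sup>2 \<le> (cmod (\<psi> z))\<^sup>2 * (cmod (f z))\<^sup>2"
        by (rule mult_right_mono) simp
      then show "(1 - K * (1 - r\<^sup>2)) * (cmod (f z))\<^sup>2 \<le> 1 * (cmod (\<psi> z * f z))\<^sup>2"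
        by (simp add: norm_mult power_mult_distrib)
    qed
    then show "(1 - K * (1 - r\<^sup>2)) * mean_square r f \<le> mean_square r (\<lambda>z. \<psi> z * f z)" by simp
  qed simp
  ultimately have "(1 - K * (1 - 1\<^sup>2)) * hardy.nsq f \<le> hardy.nsq (\<lambda>z. \<psi> z * f z)"
    by (intro tendsto_le[OF _ mean_square_tendsto[OF H]]) simp_all
  moreover have "hardy.nsq (\<lambda>z. \<psi> z * f z) \<le> 1\<^sup>2 * hardy.nsq f"
    by (rule hardy_mult_bounded[OF f \<psi> le1])
  ultimately show "hardy.nsq (\<lambda>z. \<psi> z * f z) = hardy.nsq f" by simp
qed

lemma hardy_shift:
  assumes f: "f \<in> hardy_space"
  shows "(\<lambda>z. z * f z) \<in> hardy_space" "hardy.nsq (\<lambda>z. z * f z) = hardy.nsq f"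
proof -
  note * = hardy_mult_inner_function[OF f, of "\<lambda>z. z" 1]
  show "(\<lambda>z. z * f z) \<in> hardy_space" "hardy.nsq (\<lambda>z. z * f z) = hardy.nsq f"
    by (rule *; simp add: holomorphic_on_ident)+
qed

text \<open>
  The reproducing kernel of the Hardy space at the point \<open>w\<close>.
\<close>
definition szego :: "complex \<Rightarrow> complex \<Rightarrow> complex" where
  "szego w z = (if z \<in> unit_disk then 1 / (1 - cnj w * z) else 0)"

lemma one_minus_ne_0: "w \<in> unit_disk \<Longrightarrow> z \<in> unit_disk \<Longrightarrow> 1 - cnj w * z \<noteq> 0"
proof
  assume "w \<in> unit_disk" "z \<in> unit_disk" "1 - cnj w * z = 0"
  then have "cmod w * cmod z < 1 * 1" by (intro mult_strict_mono') simp_all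
  moreover have "cmod (cnj w * z) = 1" using \<open>1 - cnj w * z = 0\<close> by (metis eq_iff_diff_eq_0 norm_one)
  ultimately show False by (simp add: norm_mult)
qed

lemma szego_coeffs:
  assumes "w \<in> unit_disk"
  shows "has_coeffs (szego w) (\<lambda>n. cnj w ^ n)" "square_summable (\<lambda>n. cnj w ^ n)"
proof -
  show "has_coeffs (szego w) (\<lambda>n. cnj w ^ n)"
    unfolding has_coeffs_def
  proof
    fix z :: complex assume z: "z \<in> unit_disk"
    have "cmod w * cmod z < 1 * 1" using assms z by (intro mult_strict_mono') simp_all
    then have "norm (cnj w * z) < 1" by (simp add: norm_mult)
    then have "(\<lambda>n. (cnj w * z) ^ n) sums (1 / (1 - cnj w * z))" by (rule geometric_sums)
    then show "(\<lambda>n. cnj w ^ n * z ^ n) sums szego w z"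
      using z by (simp add: szego_def power_mult_distrib)
  qed
  have "(cmod w)\<^sup>2 < 1" using assms by (simp add: power_less_one_iff)
  then have "summable (\<lambda>n. ((cmod w)\<^sup>2) ^ n)" by (intro summable_geometric) simp
  then show "square_summable (\<lambda>n. cnj w ^ n)"
    by (simp add: square_summable_def norm_power power_mult[symmetric] mult.commute)
qed

lemma szego_hardy: "w \<in> unit_disk \<Longrightarrow> szego w \<in> hardy_space"
  by (rule hardy_space_coeffsI[OF szego_coeffs]) (simp_all add: szego_def)

lemma szego_reproducing:
  assumes f: "f \<in> hardy_space" and w: "w \<in> unit_disk"
  shows "hardy_inner f (szego w) = f w"
proof -
  obtain a where a: "has_coeffs f a" "square_summable a" using f by (rule hardy_space_coeffs)
  have "(\<lambda>n. a n * cnj (cnj w ^ n)) sums hardy_inner f (szego w)"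
    by (rule hardy_inner_sums[OF a szego_coeffs[OF w]])
  moreover have "(\<lambda>n. a n * w ^ n) sums f w" using a(1) w by (simp add: has_coeffs_def)
  ultimately show ?thesis by (simp add: sums_unique2)
qed

text \<open>
  Taylor polynomials, cut off outside the disk so that they are elements of the Hardy space.
\<close>
definition tpoly :: "(nat \<Rightarrow> complex) \<Rightarrow> nat \<Rightarrow> complex \<Rightarrow> complex" where
  "tpoly a N z = (if z \<in> unit_disk then \<Sum>n<N. a n * z ^ n else 0)"

lemma tpoly_coeffs:
  "has_coeffs (tpoly a N) (\<lambda>n. if n < N then a n else 0)"
  "square_summable (\<lambda>n. if n < N then a n else 0)"
proof -
  show "has_coeffs (tpoly a N) (\<lambda>n. if n < N then a n else 0)"
    unfolding has_coeffs_def
  proof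
    fix z :: complex assume z: "z \<in> unit_disk"
    have "(\<lambda>n. (if n < N then a n else 0) * z ^ n) sums (\<Sum>n<N. (if n < N then a n else 0) * z ^ n)"
      by (rule sums_finite) simp_all
    then show "(\<lambda>n. (if n < N then a n else 0) * z ^ n) sums tpoly a N z"
      using z by (simp add: tpoly_def)
  qed
  show "square_summable (\<lambda>n. if n < N then a n else 0)"
    unfolding square_summable_def by (rule summable_finite[of "{..<N}"]) simp_all
qed

lemma tpoly_hardy: "tpoly a N \<in> hardy_space"
  by (rule hardy_space_coeffsI[OF tpoly_coeffs]) (simp add: tpoly_def)

lemma tpoly_nsq_diff_tendsto:
  assumes "has_coeffs f a" "square_summable a"
  shows "(\<lambda>N. hardy.nsq (\<lambda>z. tpoly a N z - f z)) \<longlonglongrightarrow> 0"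
proof -
  define A where "A = (\<lambda>n. (cmod (a n))\<^sup>2)"
  have A: "summable A" using assms(2) by (simp add: A_def square_summable_def)
  have *: "hardy.nsq (\<lambda>z. tpoly a N z - f z) = suminf A - (\<Sum>n<N. A n)" for N
  proof -
    have "has_coeffs (\<lambda>z. 1 * tpoly a N z + (-1) * f z) (\<lambda>n. 1 * (if n < N then a n else 0) + (-1) * a n)"
      by (rule has_coeffs_lincomb[OF tpoly_coeffs(1) assms(1)])
    moreover have "square_summable (\<lambda>n. 1 * (if n < N then a n else 0) + (-1) * a n)"
      by (rule square_summable_lincomb[OF tpoly_coeffs(2) assms(2)])
    ultimately have "(\<lambda>n. (cmod (1 * (if n < N then a n else 0) + (-1) * a n))\<^sup>2) sums
        hardy.nsq (\<lambda>z. 1 * tpoly a N z + (-1) * f z)"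
      unfolding hardy.nsq_def by (rule hardy_nsq_sums)
    moreover have "(\<lambda>n. A n - (if n < N then A n else 0)) sums (suminf A - (\<Sum>n<N. if n < N then A n else 0))"
      by (intro sums_diff summable_sums A sums_finite) simp_all
    moreover have "(\<lambda>n. A n - (if n < N then A n else 0)) =
        (\<lambda>n. (cmod (1 * (if n < N then a n else 0) + (-1) * a n))\<^sup>2)"
      by (simp add: A_def fun_eq_iff)
    ultimately have "hardy.nsq (\<lambda>z. 1 * tpoly a N z + (-1) * f z) = suminf A - (\<Sum>n<N. if n < N then A n else 0)"
      using sums_unique2 by metis
    then show ?thesis by simp
  qed
  have "(\<lambda>N. suminf A - (\<Sum>n<N. A n)) \<longlonglongrightarrow> suminf A - suminf A"
    by (intro tendsto_intros summable_LIMSEQ A)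
  then show ?thesis by (simp add: *)
qed

section \<open>Composition with an involutive automorphism\<close>

text \<open>
  The involutive automorphism of the disk that exchanges \<open>0\<close> and \<open>b\<close>.
\<close>
definition disk_swap :: "complex \<Rightarrow> complex \<Rightarrow> complex" where
  "disk_swap b z = (b - z) / (1 - cnj b * z)"

lemma disk_swap_0 [simp]: "disk_swap b 0 = b"
  by (simp add: disk_swap_def)

lemma disk_swap_self [simp]: "disk_swap b b = 0"
  by (simp add: disk_swap_def)

text \<open>
  The classical Schwarz-Pick identity. It shows both that the map preserves the disk and that its
  modulus tends to \<open>1\<close> at the boundary, as \<open>hardy_mult_inner_function\<close> requires.
\<close>
lemma one_minus_disk_swap_sq:
  assumes "b \<in> unit_disk" "z \<in> unit_disk"
  shows "1 - (cmod (disk_swap b z))\<^sup>2 = (1 - (cmod b)\<^sup>2) * (1 - (cmod z)\<^sup>2) / (cmod (1 - cnj b * z))\<^sup>2"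
proof -
  have "(cmod (1 - cnj b * z))\<^sup>2 - (cmod (b - z))\<^sup>2 = (1 - (cmod b)\<^sup>2) * (1 - (cmod z)\<^sup>2)"
    unfolding cmod_power2 by (simp add: power2_eq_square algebra_simps)
  moreover have "(cmod (1 - cnj b * z))\<^sup>2 \<noteq> 0" using one_minus_ne_0[OF assms] by simp
  ultimately show ?thesis
    unfolding disk_swap_def norm_divide power_divide by (metis diff_divide_distrib divide_self)
qed

lemma disk_square_less: "z \<in> unit_disk \<Longrightarrow> 0 < 1 - (cmod z)\<^sup>2"
  by (simp add: power_less_one_iff)

lemma disk_swap_in_disk:
  assumes "b \<in> unit_disk" "z \<in> unit_disk"
  shows "disk_swap b z \<in> unit_disk"
proof -
  have "0 < 1 - (cmod (disk_swap b z))\<^sup>2"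
    unfolding one_minus_disk_swap_sq[OF assms] using assms disk_square_less one_minus_ne_0[OF assms]
    by (intro divide_pos_pos mult_pos_pos) simp_all
  then show ?thesis by (simp add: power_less_one_iff)
qed

lemma disk_swap_holomorphic: "b \<in> unit_disk \<Longrightarrow> disk_swap b holomorphic_on unit_disk"
  unfolding disk_swap_def[abs_def] by (intro holomorphic_intros one_minus_ne_0)

lemma disk_swap_disk_swap:
  assumes "b \<in> unit_disk" "z \<in> unit_disk"
  shows "disk_swap b (disk_swap b z) = z"
proof -
  define d where "d = 1 - cnj b * z"
  have d: "d \<noteq> 0" using one_minus_ne_0[OF assms] by (simp add: d_def)
  have e: "1 - cnj b * b \<noteq> 0" using one_minus_ne_0[OF assms(1,1)] .
  have "b - (b - z) / d = z * (1 - cnj b * b) / d"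
    using d by (simp add: divide_simps) (simp add: d_def algebra_simps)
  moreover have "1 - cnj b * ((b - z) / d) = (1 - cnj b * b) / d"
    using d by (simp add: divide_simps) (simp add: d_def algebra_simps)
  ultimately show ?thesis
    unfolding disk_swap_def[of b "disk_swap b z"] unfolding disk_swap_def d_def[symmetric]
    using d e by simp
qed

lemma norm_one_minus_ge:
  assumes "z \<in> unit_disk"
  shows "1 - cmod b \<le> cmod (1 - cnj b * z)"
proof -
  have "1 - cmod (cnj b * z) \<le> cmod (1 - cnj b * z)"
    using norm_triangle_ineq2[of 1 "cnj b * z"] by simp
  moreover have "cmod (cnj b * z) \<le> cmod b * 1"
    unfolding norm_mult complex_mod_cnj using assms by (intro mult_left_mono) simp_all
  ultimately show ?thesis by simp
qed

lemma disk_swap_boundary_bound: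
  assumes "b \<in> unit_disk" "z \<in> unit_disk"
  shows "1 - (cmod (disk_swap b z))\<^sup>2 \<le> ((1 - (cmod b)\<^sup>2) / (1 - cmod b)\<^sup>2) * (1 - (cmod z)\<^sup>2)"
proof -
  have "(1 - cmod b)\<^sup>2 \<le> (cmod (1 - cnj b * z))\<^sup>2"
    using assms by (intro power_mono norm_one_minus_ge) simp_all
  moreover have "0 < (1 - cmod b)\<^sup>2" using assms by simp
  ultimately have "(1 - (cmod b)\<^sup>2) * (1 - (cmod z)\<^sup>2) / (cmod (1 - cnj b * z))\<^sup>2 \<le>
      (1 - (cmod b)\<^sup>2) * (1 - (cmod z)\<^sup>2) / (1 - cmod b)\<^sup>2"
    using assms disk_square_less by (intro divide_left_mono mult_nonneg_nonneg mult_pos_pos) (auto intro: less_imp_le)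
  then show ?thesis unfolding one_minus_disk_swap_sq[OF assms] by simp
qed

abbreviation disk_swap_comp :: "complex \<Rightarrow> (complex \<Rightarrow> complex) \<Rightarrow> complex \<Rightarrow> complex" where
  "disk_swap_comp b \<equiv> composition_operator (disk_swap b)"

lemma composition_operator_lincomb:
  "composition_operator \<phi> (\<lambda>z. x * f z + y * g z) =
   (\<lambda>z. x * composition_operator \<phi> f z + y * composition_operator \<phi> g z)"
  by (simp add: composition_operator_def fun_eq_iff)

lemma szego_mult_hardy:
  assumes b: "b \<in> unit_disk" and f: "f \<in> hardy_space"
  shows "(\<lambda>z. szego b z * f z) \<in> hardy_space"
    and "hardy.nsq (\<lambda>z. szego b z * f z) \<le> (1 / (1 - cmod b))\<^sup>2 * hardy.nsq f"
proof -
  have K: "cmod (szego b z) \<le> 1 / (1 - cmod b)" if "z \<in> unit_disk" for z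
  proof -
    have "1 / cmod (1 - cnj b * z) \<le> 1 / (1 - cmod b)"
      using norm_one_minus_ge[OF that, of b] b by (intro frac_le) simp_all
    then show ?thesis using that by (simp add: szego_def norm_divide)
  qed
  show "(\<lambda>z. szego b z * f z) \<in> hardy_space"
    "hardy.nsq (\<lambda>z. szego b z * f z) \<le> (1 / (1 - cmod b))\<^sup>2 * hardy.nsq f"
    by (rule hardy_mult_bounded[OF f hardy_spaceD(1)[OF szego_hardy[OF b]] K]; simp)+
qed

lemma nsq_szego: "w \<in> unit_disk \<Longrightarrow> of_real (hardy.nsq (szego w)) = szego w w"
  by (simp add: hardy.ip_self[symmetric] szego_hardy szego_reproducing)

lemma szego_self: "w \<in> unit_disk \<Longrightarrow> szego w w = of_real (1 / (1 - (cmod w)\<^sup>2))"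
  unfolding szego_def by (simp add: complex_norm_square mult.commute del: of_real_power)

lemma tpoly_Suc:
  "tpoly a (Suc N) = (\<lambda>z. a 0 * szego 0 z + 1 * (z * tpoly (\<lambda>n. a (Suc n)) N z))"
proof
  fix z
  have "(\<Sum>n<N. a (Suc n) * z ^ Suc n) = z * (\<Sum>n<N. a (Suc n) * z ^ n)"
    by (simp add: sum_distrib_left algebra_simps)
  then show "tpoly a (Suc N) z = a 0 * szego 0 z + 1 * (z * tpoly (\<lambda>n. a (Suc n)) N z)"
    by (simp only: tpoly_def szego_def sum.lessThan_Suc_shift) simp
qed

text \<open>
  Induction on the degree through \<open>f = f(0) + z f\<^sub>1\<close>. On one side this becomes \<open>f(0) + \<phi> (C f\<^sub>1)\<close>, on the
  other \<open>f(0) k + z k f\<^sub>1\<close>. As multiplication by \<open>\<phi>\<close> and by \<open>z\<close> is isometric, the squared norms of the second summands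
  are related by the induction hypothesis; the mixed terms agree because the reproducing
  properties of \<open>1\<close> and of \<open>k\<close> reduce both to \<open>b f\<^sub>1(b)\<close>.
\<close>
lemma disk_swap_comp_tpoly:
  assumes b: "b \<in> unit_disk"
  shows "disk_swap_comp b (tpoly a N) \<in> hardy_space \<and>
    hardy.nsq (disk_swap_comp b (tpoly a N)) =
      (1 - (cmod b)\<^sup>2) * hardy.nsq (\<lambda>z. szego b z * tpoly a N z)"
proof (induction N arbitrary: a)
  case 0
  have zH: "(\<lambda>z. 0) \<in> hardy_space" using hardy_space_lincomb[OF tpoly_hardy tpoly_hardy, of 0 _ _ 0] by simp
  then have "hardy.nsq (\<lambda>z. 0) = 0" using hardy.nsq_lincomb[OF zH zH, of 0 0] by simp
  moreover have "tpoly a 0 = (\<lambda>z. 0)" by (simp add: tpoly_def fun_eq_iff)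
  moreover have "disk_swap_comp b (\<lambda>z. 0) = (\<lambda>z. 0)" by (simp add: composition_operator_def fun_eq_iff)
  ultimately show ?case using zH by simp
next
  case (Suc N)
  define P where "P = tpoly (\<lambda>n. a (Suc n)) N"
  define F where "F = (\<lambda>z. disk_swap b z * disk_swap_comp b P z)"
  define G where "G = (\<lambda>z. szego b z * P z)"
  have PH: "P \<in> hardy_space" unfolding P_def by (rule tpoly_hardy)
  have CP: "disk_swap_comp b P \<in> hardy_space"
    and IH: "hardy.nsq (disk_swap_comp b P) = (1 - (cmod b)\<^sup>2) * hardy.nsq G"
    using Suc.IH by (simp_all add: P_def G_def)
  have 0: "(0::complex) \<in> unit_disk" by simp
  have le1: "cmod (disk_swap b z) \<le> 1" if "z \<in> unit_disk" for z
    using disk_swap_in_disk[OF b that] by simp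
  have FH: "F \<in> hardy_space" and F: "hardy.nsq F = hardy.nsq (disk_swap_comp b P)"
    unfolding F_def
    by (rule hardy_mult_inner_function[OF CP disk_swap_holomorphic[OF b] le1 disk_swap_boundary_bound[OF b]]; simp)+
  have GH: "G \<in> hardy_space" unfolding G_def by (rule szego_mult_hardy[OF b PH])
  have zGH: "(\<lambda>z. z * G z) \<in> hardy_space" and zG: "hardy.nsq (\<lambda>z. z * G z) = hardy.nsq G"
    by (rule hardy_shift[OF GH])+
  have C_eq: "disk_swap_comp b (tpoly a (Suc N)) = (\<lambda>z. a 0 * szego 0 z + 1 * F z)"
    unfolding tpoly_Suc P_def[symmetric] composition_operator_def F_def
    using disk_swap_in_disk[OF b] by (auto simp: szego_def fun_eq_iff)
  have k_eq: "(\<lambda>z. szego b z * tpoly a (Suc N) z) = (\<lambda>z. a 0 * szego b z + 1 * (z * G z))"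
    unfolding tpoly_Suc P_def[symmetric] G_def by (auto simp: szego_def fun_eq_iff algebra_simps)
  define q where "q = 1 - (cmod b)\<^sup>2"
  have q: "0 < q" using disk_square_less[OF b] by (simp add: q_def)
  have kb: "szego b b = of_real (1 / q)" unfolding q_def by (rule szego_self[OF b])
  have "hardy_inner F (szego 0) = b * P b"
    unfolding szego_reproducing[OF FH 0] by (simp add: F_def composition_operator_def)
  then have i1: "hardy_inner (szego 0) F = cnj (b * P b)"
    using hardy_inner_cnj[OF FH szego_hardy[OF 0]] by simp
  have "hardy_inner (\<lambda>z. z * G z) (szego b) = b * (of_real (1 / q) * P b)"
    unfolding szego_reproducing[OF zGH b] by (simp only: G_def kb)
  then have i2: "of_real q * hardy_inner (szego b) (\<lambda>z. z * G z) = cnj (b * P b)"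
    using hardy_inner_cnj[OF zGH szego_hardy[OF b]] q by simp
  have n0: "hardy.nsq (szego 0) = 1" using nsq_szego[OF 0] szego_self[OF 0] by simp
  have nb: "q * hardy.nsq (szego b) = 1" 
    using nsq_szego[OF b] q unfolding kb of_real_eq_iff by simp
  have "hardy.nsq (disk_swap_comp b (tpoly a (Suc N))) =
      (cmod (a 0))\<^sup>2 + q * hardy.nsq G + 2 * Re (a 0 * cnj (b * P b))"
    unfolding C_eq hardy.nsq_lincomb[OF szego_hardy[OF 0] FH] i1 n0 F IH by (simp add: q_def)
  moreover have "q * hardy.nsq (\<lambda>z. szego b z * tpoly a (Suc N) z) =
      (cmod (a 0))\<^sup>2 * (q * hardy.nsq (szego b)) + q * hardy.nsq G +
      2 * Re (a 0 * (of_real q * hardy_inner (szego b) (\<lambda>z. z * G z)))"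
    unfolding k_eq hardy.nsq_lincomb[OF szego_hardy[OF b] zGH] zG by (simp add: algebra_simps)
  ultimately have "hardy.nsq (disk_swap_comp b (tpoly a (Suc N))) = q * hardy.nsq (\<lambda>z. szego b z * tpoly a (Suc N) z)"
    unfolding nb i2 by simp
  moreover have "disk_swap_comp b (tpoly a (Suc N)) \<in> hardy_space"
    unfolding C_eq by (rule hardy_space_lincomb[OF szego_hardy[OF 0] FH])
  ultimately show ?case by (simp add: q_def)
qed

lemma mean_square_uniform_limit:
  assumes F: "\<And>n. continuous_on unit_disk (F n)" and g: "continuous_on unit_disk g" and r: "0 \<le> r" "r < 1"
    and lim: "uniform_limit {0..2*pi} (\<lambda>n \<theta>. F n (of_real r * cis \<theta>)) (\<lambda>\<theta>. g (of_real r * cis \<theta>)) sequentially"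
  shows "(\<lambda>n. mean_square r (F n)) \<longlonglongrightarrow> mean_square r g"
proof -
  have u: "uniform_limit {0..2*pi} (\<lambda>n \<theta>. cmod (F n (of_real r * cis \<theta>))) (\<lambda>\<theta>. cmod (g (of_real r * cis \<theta>))) sequentially"
    by (rule uniform_limit_norm[OF lim])
  have "continuous_on {0..2*pi} (\<lambda>\<theta>. cmod (g (of_real r * cis \<theta>)))"
    by (intro continuous_intros continuous_on_circle g r)
  then have bdd: "bounded ((\<lambda>\<theta>. cmod (g (of_real r * cis \<theta>))) ` {0..2*pi})"
    by (intro compact_imp_bounded compact_continuous_image) auto
  have u2: "uniform_limit {0..2*pi} (\<lambda>n \<theta>. (cmod (F n (of_real r * cis \<theta>)))\<^sup>2) (\<lambda>\<theta>. (cmod (g (of_real r * cis \<theta>)))\<^sup>2) sequentially"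
    unfolding power2_eq_square by (rule uniform_lim_mult[OF u u bdd bdd])
  have c: "continuous_on {0..2*pi} (\<lambda>\<theta>. (cmod (F n (of_real r * cis \<theta>)))\<^sup>2)" for n
    by (intro continuous_intros continuous_on_circle F r)
  obtain I J where I: "\<And>n. ((\<lambda>\<theta>. (cmod (F n (of_real r * cis \<theta>)))\<^sup>2) has_integral I n) {0..2*pi}"
    and J: "((\<lambda>\<theta>. (cmod (g (of_real r * cis \<theta>)))\<^sup>2) has_integral J) {0..2*pi}"
    and IJ: "I \<longlonglongrightarrow> J"
    using uniform_limit_integral[OF u2 c sequentially_bot] by blast
  have "(\<lambda>n. I n / (2*pi)) \<longlonglongrightarrow> J / (2*pi)" by (intro tendsto_intros IJ) simp
  then show ?thesis unfolding mean_square_def integral_unique[OF I] integral_unique[OF J] .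
qed

text \<open>
  The image of a circle in the disk stays in a smaller concentric disk of radius \<open>\<rho> < 1\<close>, where the
  Taylor series converges uniformly.
\<close>
lemma tpoly_disk_swap_uniform_limit:
  assumes b: "b \<in> unit_disk" and f: "has_coeffs f a" and r: "0 \<le> r" "r < 1"
  shows "uniform_limit {0..2*pi} (\<lambda>N \<theta>. disk_swap_comp b (tpoly a N) (of_real r * cis \<theta>))
    (\<lambda>\<theta>. disk_swap_comp b f (of_real r * cis \<theta>)) sequentially"
proof -
  define \<rho> where "\<rho> = sqrt (1 - (1 - (cmod b)\<^sup>2) * (1 - r\<^sup>2) / 4)"
  have r2: "0 < 1 - r\<^sup>2" using r by (simp add: power_less_one_iff)
  have b2: "0 < 1 - (cmod b)\<^sup>2" by (rule disk_square_less[OF b])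
  have "\<rho> < 1" unfolding \<rho>_def using r2 b2 by (simp add: mult_pos_pos)
  have m: "disk_swap b (of_real r * cis \<theta>) \<in> cball 0 \<rho>" for \<theta>
  proof -
    define z where "z = of_real r * cis \<theta>"
    have z: "z \<in> unit_disk" "cmod z = r" using r by (simp_all add: z_def norm_mult)
    have "cmod (1 - cnj b * z) \<le> 1 + cmod b * cmod z"
      using norm_triangle_ineq4[of 1 "cnj b * z"] by (simp add: norm_mult)
    also have "cmod b * cmod z \<le> 1 * 1" using b z r by (intro mult_mono) simp_all
    finally have "(cmod (1 - cnj b * z))\<^sup>2 \<le> 2\<^sup>2" by (intro power_mono) simp_all
    moreover have "0 < (cmod (1 - cnj b * z))\<^sup>2" using one_minus_ne_0[OF b z(1)] by simp
    ultimately have "(1 - (cmod b)\<^sup>2) * (1 - r\<^sup>2) / 4 \<le> (1 - (cmod b)\<^sup>2) * (1 - r\<^sup>2) / (cmod (1 - cnj b * z))\<^sup>2"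
      using r2 b2 by (intro divide_left_mono) simp_all
    then have "(cmod (disk_swap b z))\<^sup>2 \<le> 1 - (1 - (cmod b)\<^sup>2) * (1 - r\<^sup>2) / 4"
      using one_minus_disk_swap_sq[OF b z(1)] unfolding z(2) by linarith
    then show ?thesis unfolding z_def[symmetric] \<rho>_def by (simp add: real_le_rsqrt)
  qed
  have "uniform_limit {0..2*pi} (\<lambda>N \<theta>. \<Sum>n<N. a n * disk_swap b (of_real r * cis \<theta>) ^ n)
     (\<lambda>\<theta>. f (disk_swap b (of_real r * cis \<theta>))) sequentially"
    by (rule uniform_limit_compose'[OF has_coeffs_uniform_limit[OF f \<open>\<rho> < 1\<close>]]) (use m in blast)
  moreover have "disk_swap b (of_real r * cis \<theta>) \<in> unit_disk" for \<theta>
    by (rule disk_swap_in_disk[OF b circle_in_disk[OF r]])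
  ultimately show ?thesis using circle_in_disk[OF r] by (simp add: composition_operator_def tpoly_def)
qed

lemma disk_swap_comp_holomorphic:
  assumes b: "b \<in> unit_disk" and f: "f holomorphic_on unit_disk"
  shows "disk_swap_comp b f holomorphic_on unit_disk"
proof -
  have "(f \<circ> disk_swap b) holomorphic_on unit_disk"
    by (rule holomorphic_on_compose_gen[OF disk_swap_holomorphic[OF b] f]) (use disk_swap_in_disk[OF b] in blast)
  then show ?thesis by (rule holomorphic_transform) (simp add: composition_operator_def)
qed

text \<open>
  Boundedness for polynomials is contained in \<open>disk_swap_comp_tpoly\<close>. It passes to all \<open>f\<close> because, on
  each circle, \<open>C\<close> applied to the Taylor polynomials converges uniformly to \<open>C f\<close>.
\<close>
lemma disk_swap_comp_bounded:
  assumes b: "b \<in> unit_disk" and f: "f \<in> hardy_space"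
  shows "disk_swap_comp b f \<in> hardy_space"
    and "hardy.nsq (disk_swap_comp b f) \<le> (1 - (cmod b)\<^sup>2) * (1 / (1 - cmod b))\<^sup>2 * hardy.nsq f"
proof -
  obtain a where a: "has_coeffs f a" "square_summable a" using f by (rule hardy_space_coeffs)
  define K where "K = (1 - (cmod b)\<^sup>2) * (1 / (1 - cmod b))\<^sup>2"
  note hol = disk_swap_comp_holomorphic[OF b hardy_spaceD(1)[OF f]]
  have CP: "disk_swap_comp b (tpoly a N) \<in> hardy_space" for N using disk_swap_comp_tpoly[OF b] by blast
  have B: "mean_square r (disk_swap_comp b f) \<le> K * hardy.nsq f" if r: "0 \<le> r" "r < 1" for r
  proof (rule LIMSEQ_le)
    show "(\<lambda>N. mean_square r (disk_swap_comp b (tpoly a N))) \<longlonglongrightarrow> mean_square r (disk_swap_comp b f)"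
      by (intro mean_square_uniform_limit hardy_continuous CP holomorphic_on_imp_continuous_on hol
          tpoly_disk_swap_uniform_limit b a r)
    show "(\<lambda>N. K * hardy.nsq (tpoly a N)) \<longlonglongrightarrow> K * hardy.nsq f"
      by (intro tendsto_intros hardy.norm_tendsto tpoly_hardy f tpoly_nsq_diff_tendsto a)
    have "mean_square r (disk_swap_comp b (tpoly a N)) \<le> K * hardy.nsq (tpoly a N)" for N
    proof -
      have "mean_square r (disk_swap_comp b (tpoly a N)) \<le> hardy.nsq (disk_swap_comp b (tpoly a N))"
        by (rule mean_square_le_nsq[OF CP r])
      also have "\<dots> = (1 - (cmod b)\<^sup>2) * hardy.nsq (\<lambda>z. szego b z * tpoly a N z)"
        using disk_swap_comp_tpoly[OF b] by blast
      also have "\<dots> \<le> (1 - (cmod b)\<^sup>2) * ((1 / (1 - cmod b))\<^sup>2 * hardy.nsq (tpoly a N))"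
        using disk_square_less[OF b] by (intro mult_left_mono szego_mult_hardy b tpoly_hardy) simp
      finally show ?thesis by (simp add: K_def)
    qed
    then show "\<exists>n0. \<forall>N\<ge>n0. mean_square r (disk_swap_comp b (tpoly a N)) \<le> K * hardy.nsq (tpoly a N)"
      by blast
  qed
  have 0: "disk_swap_comp b f z = 0" if "z \<notin> unit_disk" for z
    using that by (simp add: composition_operator_def)
  show "disk_swap_comp b f \<in> hardy_space"
    "hardy.nsq (disk_swap_comp b f) \<le> (1 - (cmod b)\<^sup>2) * (1 / (1 - cmod b))\<^sup>2 * hardy.nsq f"
    unfolding K_def[symmetric] by (rule hardy_spaceI_nsq[OF hol 0 B]; simp)+
qed

text \<open>
  Both sides are continuous in \<open>f\<close> and polynomials are dense.
\<close>
theorem disk_swap_comp_nsq: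
  assumes b: "b \<in> unit_disk" and f: "f \<in> hardy_space"
  shows "hardy.nsq (disk_swap_comp b f) = (1 - (cmod b)\<^sup>2) * hardy.nsq (\<lambda>z. szego b z * f z)"
proof -
  obtain a where a: "has_coeffs f a" "square_summable a" using f by (rule hardy_space_coeffs)
  define D where "D = (\<lambda>N z. 1 * tpoly a N z + (-1) * f z)"
  have DH: "D N \<in> hardy_space" for N unfolding D_def by (rule hardy_space_lincomb[OF tpoly_hardy f])
  have D0: "(\<lambda>N. hardy.nsq (D N)) \<longlonglongrightarrow> 0" using tpoly_nsq_diff_tendsto[OF a] by (simp add: D_def)
  have null: "(\<lambda>N. hardy.nsq (F N)) \<longlonglongrightarrow> 0"
    if "\<And>N. F N \<in> hardy_space" "\<And>N. hardy.nsq (F N) \<le> K * hardy.nsq (D N)" for F K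
  proof (rule tendsto_sandwich[OF _ _ tendsto_const])
    show "(\<lambda>N. K * hardy.nsq (D N)) \<longlonglongrightarrow> 0" using tendsto_mult_left[OF D0, of K] by simp
  qed (use that hardy.nsq_nonneg in simp_all)
  have "(\<lambda>N. hardy.nsq (disk_swap_comp b (tpoly a N))) \<longlonglongrightarrow> hardy.nsq (disk_swap_comp b f)"
  proof (rule hardy.norm_tendsto)
    have "(\<lambda>N. hardy.nsq (disk_swap_comp b (D N))) \<longlonglongrightarrow> 0"
      by (rule null[OF disk_swap_comp_bounded[OF b DH]])
    then show "(\<lambda>N. hardy.nsq (\<lambda>z. disk_swap_comp b (tpoly a N) z - disk_swap_comp b f z)) \<longlonglongrightarrow> 0"
      unfolding D_def composition_operator_lincomb by simp
  qed (rule disk_swap_comp_bounded[OF b] tpoly_hardy f)+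
  moreover have "(\<lambda>N. hardy.nsq (disk_swap_comp b (tpoly a N))) \<longlonglongrightarrow>
      (1 - (cmod b)\<^sup>2) * hardy.nsq (\<lambda>z. szego b z * f z)"
  proof -
    have "(\<lambda>N. hardy.nsq (\<lambda>z. szego b z * tpoly a N z)) \<longlonglongrightarrow> hardy.nsq (\<lambda>z. szego b z * f z)"
    proof (rule hardy.norm_tendsto)
      have "(\<lambda>N. hardy.nsq (\<lambda>z. szego b z * D N z)) \<longlonglongrightarrow> 0"
        by (rule null[OF szego_mult_hardy[OF b DH]])
      then show "(\<lambda>N. hardy.nsq (\<lambda>z. szego b z * tpoly a N z - szego b z * f z)) \<longlonglongrightarrow> 0"
        by (simp add: D_def right_diff_distrib)
    qed (rule szego_mult_hardy[OF b] tpoly_hardy f)+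
    then have "(\<lambda>N. (1 - (cmod b)\<^sup>2) * hardy.nsq (\<lambda>z. szego b z * tpoly a N z)) \<longlonglongrightarrow>
        (1 - (cmod b)\<^sup>2) * hardy.nsq (\<lambda>z. szego b z * f z)"
      by (rule tendsto_mult_left)
    then show ?thesis using disk_swap_comp_tpoly[OF b] by simp
  qed
  ultimately show ?thesis by (rule LIMSEQ_unique)
qed

section \<open>The angle between the eigenspaces\<close>

lemma hardy_shift_inner:
  assumes "f \<in> hardy_space" "g \<in> hardy_space"
  shows "hardy_inner (\<lambda>z. z * f z) (\<lambda>z. z * g z) = hardy_inner f g"
  using hardy.polarization[where T = "\<lambda>f z. z * f z" and S = "\<lambda>f. f" and r = 1, OF hardy_shift(1) _ _ _ _ assms]
  by (simp add: hardy_shift(2) algebra_simps)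

lemma disk_swap_comp_inner:
  assumes b: "b \<in> unit_disk" and f: "f \<in> hardy_space" and g: "g \<in> hardy_space"
  shows "hardy_inner (disk_swap_comp b f) (disk_swap_comp b g) =
    of_real (1 - (cmod b)\<^sup>2) * hardy_inner (\<lambda>z. szego b z * f z) (\<lambda>z. szego b z * g z)"
proof (rule hardy.polarization[where T = "disk_swap_comp b" and S = "\<lambda>f z. szego b z * f z"])
  show "(\<lambda>z. szego b z * (x * f z + y * g z)) = (\<lambda>z. x * (szego b z * f z) + y * (szego b z * g z))"
    for f g :: "complex \<Rightarrow> complex" and x y
    by (simp add: fun_eq_iff algebra_simps)
qed (intro disk_swap_comp_bounded szego_mult_hardy disk_swap_comp_nsq composition_operator_lincomb b f g; assumption)+

text \<open>
  Recovers \<open>f\<close> from \<open>h = k f\<close> as \<open>h - cnj b z h\<close>, using nothing beyond the shift.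
\<close>
lemma szego_mult_cancel:
  assumes b: "b \<in> unit_disk" and f: "f \<in> hardy_space"
  shows "f = (\<lambda>z. 1 * (szego b z * f z) + (- cnj b) * (z * (szego b z * f z)))"
proof
  fix z
  have "f z = (1 - cnj b * z) * (szego b z * f z)"
  proof (cases "z \<in> unit_disk")
    case True
    then show ?thesis using one_minus_ne_0[OF b True] by (simp add: szego_def)
  next
    case False
    then show ?thesis using hardy_spaceD(2)[OF f] by simp
  qed
  then show "f z = 1 * (szego b z * f z) + (- cnj b) * (z * (szego b z * f z))"
    by (simp add: algebra_simps)
qed

text \<open>
  Two equalities in the Cauchy-Schwarz inequality give \<open>n h = \<alpha> z g\<close> and \<open>n z h = \<beta> g\<close> with \<open>n = |g|\<^sup>2\<close>, hence
  \<open>(\<alpha> z\<^sup>2 - \<beta>) h = 0\<close> with \<open>|\<alpha>| = |\<beta>| > 0\<close>; the factor has no zero in the disk.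
\<close>
lemma shift_inner_not_both_extremal:
  assumes h: "h \<in> hardy_space" and g: "g \<in> hardy_space" and pos: "0 < hardy.nsq h" "0 < hardy.nsq g"
    and A: "(cmod (hardy_inner h (\<lambda>z. z * g z)))\<^sup>2 = hardy.nsq h * hardy.nsq g"
    and B: "(cmod (hardy_inner (\<lambda>z. z * h z) g))\<^sup>2 = hardy.nsq h * hardy.nsq g"
  shows False
proof -
  define \<alpha> \<beta> where "\<alpha> = hardy_inner h (\<lambda>z. z * g z)" and "\<beta> = hardy_inner (\<lambda>z. z * h z) g"
  have eq1: "of_real (hardy.nsq g) * h z = \<alpha> * (z * g z)" for z
    using hardy.cauchy_schwarz_eq[OF h hardy_shift(1)[OF g]] A hardy_shift(2)[OF g]
    by (simp add: \<alpha>_def)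
  have eq2: "of_real (hardy.nsq g) * (z * h z) = \<beta> * g z" for z
    using hardy.cauchy_schwarz_eq[OF hardy_shift(1)[OF h] g] B hardy_shift(2)[OF h]
    by (simp add: \<beta>_def)
  have "(cmod \<alpha>)\<^sup>2 = (cmod \<beta>)\<^sup>2" using A B by (simp add: \<alpha>_def \<beta>_def)
  then have ab: "cmod \<alpha> = cmod \<beta>" by (simp add: power2_eq_iff_nonneg)
  have b0: "cmod \<beta> > 0" using B pos by (auto simp: \<beta>_def)
  have "h z = 0" for z
  proof (cases "z \<in> unit_disk")
    case True
    have "of_real (hardy.nsq g) * (h z * (\<alpha> * z\<^sup>2 - \<beta>)) =
        \<alpha> * z * (of_real (hardy.nsq g) * (z * h z)) - \<beta> * (of_real (hardy.nsq g) * h z)"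
      by (simp add: algebra_simps power2_eq_square)
    also have "\<dots> = 0" unfolding eq1 eq2 by (simp add: algebra_simps)
    finally have "h z = 0 \<or> \<alpha> * z\<^sup>2 = \<beta>" using pos by simp
    moreover have "\<alpha> * z\<^sup>2 \<noteq> \<beta>"
    proof
      assume "\<alpha> * z\<^sup>2 = \<beta>"
      then have "cmod \<beta> * (cmod z)\<^sup>2 = cmod \<beta>" unfolding ab[symmetric] by (metis ab norm_mult norm_power)
      then have "(cmod z)\<^sup>2 = 1" using b0 by simp
      then show False using disk_square_less[OF True] by simp
    qed
    ultimately show ?thesis by blast
  next
    case False
    then show ?thesis by (rule hardy_spaceD(2)[OF h])
  qed
  then have "h = (\<lambda>z. 0 * h z + 0 * h z)" by (simp add: fun_eq_iff)
  then have "hardy.nsq h = 0" using hardy.nsq_lincomb[OF h h, of 0 0] by simp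
  with pos show False by simp
qed

text \<open>
  The point of passing from \<open>u\<close>, \<open>v\<close> to \<open>h = k u\<close>, \<open>g = k v\<close> is that \<open>\<langle>u, v\<rangle>\<close> can be written in two ways in
  terms of \<open>h\<close> and \<open>g\<close>: by the transport identity for \<open>C\<close> and by expanding \<open>u = h - cnj b z h\<close>. Comparing
  the two yields \<open>2 X = b A + cnj b B\<close>, where \<open>A\<close> and \<open>B\<close> are bounded by \<open>|h| |g|\<close> but cannot both attain it.
\<close>
lemma eigenfunctions_angle:
  assumes b: "b \<in> unit_disk" "b \<noteq> 0" and u: "u \<in> hardy_space" and v: "v \<in> hardy_space"
    and Cu: "disk_swap_comp b u = u" and Cv: "disk_swap_comp b v = (\<lambda>z. - v z)"
    and u0: "hardy.nsq u \<noteq> 0" and v0: "hardy.nsq v \<noteq> 0"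
  shows "(cmod (hardy_inner u v))\<^sup>2 < (cmod b)\<^sup>2 * (hardy.nsq u * hardy.nsq v)"
proof -
  define h g where "h = (\<lambda>z. szego b z * u z)" and "g = (\<lambda>z. szego b z * v z)"
  define q where "q = 1 - (cmod b)\<^sup>2"
  have q: "0 < q" using disk_square_less[OF b(1)] by (simp add: q_def)
  have h: "h \<in> hardy_space" and g: "g \<in> hardy_space"
    unfolding h_def g_def by (intro szego_mult_hardy b u v)+
  have nv: "hardy.nsq (\<lambda>z. - v z) = hardy.nsq v" using hardy.nsq_lincomb[OF v v, of "-1" 0] by simp
  have nu: "hardy.nsq u = q * hardy.nsq h"
    using disk_swap_comp_nsq[OF b(1) u] unfolding Cu h_def q_def .
  have nv: "hardy.nsq v = q * hardy.nsq g"
    using disk_swap_comp_nsq[OF b(1) v] unfolding Cv nv g_def q_def .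
  have hg0: "0 < hardy.nsq h" "0 < hardy.nsq g"
    using u0 v0 nu nv hardy.nsq_nonneg[OF h] hardy.nsq_nonneg[OF g] by (auto simp: less_le)
  define X where "X = hardy_inner h g"
  define A where "A = hardy_inner h (\<lambda>z. z * g z)"
  define B where "B = hardy_inner (\<lambda>z. z * h z) g"
  have "hardy_inner u (\<lambda>z. - v z) = - hardy_inner u v"
    using hardy.ip_lincomb_right[OF v v u, of "-1" 0] by simp
  then have uv: "hardy_inner u v = - (of_real q * X)"
    using disk_swap_comp_inner[OF b(1) u v] unfolding Cu Cv X_def h_def g_def q_def
    by (metis minus_equation_iff)
  have u_eq: "u = (\<lambda>z. 1 * h z + (- cnj b) * (z * h z))" unfolding h_def by (rule szego_mult_cancel[OF b(1) u])
  have v_eq: "v = (\<lambda>z. 1 * g z + (- cnj b) * (z * g z))" unfolding g_def by (rule szego_mult_cancel[OF b(1) v])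
  have "hardy_inner u v = X - b * A - cnj b * B + of_real ((cmod b)\<^sup>2) * X"
  proof -
    note zh = hardy_shift(1)[OF h] and zg = hardy_shift(1)[OF g]
    have "hardy_inner u v = hardy_inner h v - cnj b * hardy_inner (\<lambda>z. z * h z) v"
      using hardy.ip_lincomb[OF h zh v, of 1 "- cnj b", folded u_eq] by simp
    moreover have "hardy_inner h v = X - b * A"
      using hardy.ip_lincomb_right[OF g zg h, of 1 "- cnj b", folded v_eq] by (simp add: X_def A_def)
    moreover have "hardy_inner (\<lambda>z. z * h z) v = B - b * X"
      using hardy.ip_lincomb_right[OF g zg zh, of 1 "- cnj b", folded v_eq]
      by (simp add: B_def X_def hardy_shift_inner[OF h g])
    ultimately show ?thesis unfolding complex_norm_square by (simp add: algebra_simps)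
  qed
  then have X: "2 * X = b * A + cnj b * B" unfolding uv q_def by (simp add: algebra_simps)
  define N where "N = hardy.nsq h * hardy.nsq g"
  have N: "0 < N" using hg0 by (simp add: N_def)
  have A_le: "(cmod A)\<^sup>2 \<le> N"
    using hardy.cauchy_schwarz[OF h hardy_shift(1)[OF g]] hardy_shift(2)[OF g] by (simp add: A_def N_def)
  have B_le: "(cmod B)\<^sup>2 \<le> N"
    using hardy.cauchy_schwarz[OF hardy_shift(1)[OF h] g] hardy_shift(2)[OF h] by (simp add: B_def N_def)
  have not_both: "\<not> ((cmod A)\<^sup>2 = N \<and> (cmod B)\<^sup>2 = N)"
    using shift_inner_not_both_extremal[OF h g hg0] unfolding A_def B_def N_def by blast
  have "cmod A + cmod B < 2 * sqrt N"
  proof -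
    have "cmod A \<le> sqrt N" "cmod B \<le> sqrt N" using A_le B_le by (simp_all add: real_le_rsqrt)
    moreover have "\<not> (cmod A = sqrt N \<and> cmod B = sqrt N)" using not_both N by auto
    ultimately show ?thesis by linarith
  qed
  then have "cmod b * (cmod A + cmod B) < cmod b * (2 * sqrt N)" using b(2) by simp
  moreover have "cmod (2 * X) \<le> cmod b * (cmod A + cmod B)"
    unfolding X using norm_triangle_ineq[of "b * A" "cnj b * B"] by (simp add: norm_mult distrib_left)
  ultimately have "cmod X < cmod b * sqrt N" by (simp add: norm_mult)
  then have "(cmod X)\<^sup>2 < (cmod b * sqrt N)\<^sup>2" by (intro power_strict_mono) simp_all
  then have "q\<^sup>2 * (cmod X)\<^sup>2 < q\<^sup>2 * ((cmod b)\<^sup>2 * N)" using q N by (simp add: power_mult_distrib)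
  then show ?thesis unfolding uv nu nv N_def
    by (simp add: norm_mult power_mult_distrib power2_eq_square algebra_simps)
qed

lemma disk_swap_comp_involution:
  assumes b: "b \<in> unit_disk" and f: "f \<in> hardy_space"
  shows "disk_swap_comp b (disk_swap_comp b f) = f"
proof
  fix z
  show "disk_swap_comp b (disk_swap_comp b f) z = f z"
  proof (cases "z \<in> unit_disk")
    case True
    have "disk_swap_comp b (disk_swap_comp b f) z = f (disk_swap b (disk_swap b z))"
      using True disk_swap_in_disk[OF b True] by (simp only: composition_operator_def if_True)
    then show ?thesis by (simp only: disk_swap_disk_swap[OF b True])
  next
    case False
    then show ?thesis using hardy_spaceD(2)[OF f] by (simp add: composition_operator_def)
  qed
qed

text \<open>
  With \<open>c = |b|\<close> and \<open>k f = h\<close> the Szego kernel of \<open>w = t b / c\<close>, the reproducing property gives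
  \<open>|f|\<^sup>2 = (1 + c\<^sup>2 - 2 c t) |h|\<^sup>2\<close> and \<open>|C f|\<^sup>2 = (1 - c\<^sup>2) |h|\<^sup>2\<close>. For \<open>u = f + C f\<close> and \<open>v = f - C f\<close> the real
  part of \<open>\<langle>u, v\<rangle>\<close> is \<open>|f|\<^sup>2 - |C f|\<^sup>2\<close> and \<open>|u| |v| \<le> |f|\<^sup>2 + |C f|\<^sup>2\<close>, so the cosine is at least
  \<open>c (t - c) / (1 - c t)\<close>, which tends to \<open>c\<close> as \<open>t\<close> tends to \<open>1\<close>.
\<close>
lemma eigenfunctions_angle_sharp:
  assumes b: "b \<in> unit_disk" "b \<noteq> 0" and e: "e < cmod b"
  shows "\<exists>u\<in>hardy_space. \<exists>v\<in>hardy_space. disk_swap_comp b u = u \<and> disk_swap_comp b v = (\<lambda>z. - v z) \<and>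
      hardy.nsq u \<noteq> 0 \<and> hardy.nsq v \<noteq> 0 \<and>
      e * sqrt (hardy.nsq u * hardy.nsq v) < cmod (hardy_inner u v)"
proof -
  define c where "c = cmod b"
  have c: "0 < c" "c < 1" using b by (simp_all add: c_def)
  define d where "d = max 0 e"
  have d: "0 \<le> d" "d < c" "e \<le> d" using e c by (simp_all add: d_def c_def)
  have "((\<lambda>t. d * (1 - c * t) - c * (t - c)) \<longlongrightarrow> d * (1 - c * 1) - c * (1 - c)) (at_left 1)"
    by (intro tendsto_intros)
  moreover have "d * (1 - c * 1) - c * (1 - c) < 0" using c d by simp
  ultimately have "\<forall>\<^sub>F t in at_left 1. d * (1 - c * t) - c * (t - c) < 0" by (rule order_tendstoD)
  moreover have "\<forall>\<^sub>F t in at_left (1::real). t \<in> {0<..<1}"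
    by (rule eventually_at_leftI[of 0]) simp_all
  ultimately have "\<forall>\<^sub>F t in at_left (1::real). t \<in> {0<..<1} \<and> d * (1 - c * t) - c * (t - c) < 0"
    by eventually_elim simp
  then obtain t where t: "0 < t" "t < 1" "d * (1 - c * t) < c * (t - c)"
    using eventually_happens'[OF trivial_limit_at_left_real] by force
  have ct: "c * t < 1" using c t mult_strict_mono'[of c 1 t 1] by simp
  define w where "w = of_real (t / c) * b"
  have "cmod w = t" unfolding w_def norm_mult norm_of_real c_def[symmetric] using c t by simp
  then have w: "w \<in> unit_disk" using t by simp
  define h where "h = szego w"
  have h: "h \<in> hardy_space" unfolding h_def by (rule szego_hardy[OF w])
  define n where "n = hardy.nsq h"
  have hw: "h w = of_real n" unfolding n_def h_def using nsq_szego[OF w] by simp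
  have n: "0 < n"
    using nsq_szego[OF w] szego_self[OF w] disk_square_less[OF w] unfolding n_def h_def
    by (simp only: of_real_eq_iff) simp
  define f where "f = (\<lambda>z. 1 * h z + (- cnj b) * (z * h z))"
  have f: "f \<in> hardy_space" unfolding f_def by (intro hardy_space_lincomb h hardy_shift(1))
  have kf: "(\<lambda>z. szego b z * f z) = h"
  proof
    fix z
    show "szego b z * f z = h z"
    proof (cases "z \<in> unit_disk")
      case True
      have "f z = (1 - cnj b * z) * h z" by (simp add: f_def algebra_simps)
      then show ?thesis using one_minus_ne_0[OF b(1) True] True by (simp add: szego_def)
    next
      case False
      then show ?thesis by (simp add: szego_def h_def)
    qed
  qed
  have nCf: "hardy.nsq (disk_swap_comp b f) = (1 - c\<^sup>2) * n"
    unfolding disk_swap_comp_nsq[OF b(1) f] kf c_def n_def ..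
  have "hardy_inner (\<lambda>z. z * h z) h = w * of_real n"
    using szego_reproducing[OF hardy_shift(1)[OF h] w] unfolding h_def[symmetric] hw .
  then have i: "hardy_inner h (\<lambda>z. z * h z) = cnj w * of_real n"
    using hardy_inner_cnj[OF hardy_shift(1)[OF h] h] by simp
  have bw: "b * cnj w = of_real (c * t)"
  proof -
    have "b * cnj w = of_real (t / c) * (b * cnj b)" by (simp add: w_def)
    also have "\<dots> = of_real (t / c * c\<^sup>2)" unfolding complex_norm_square[symmetric] c_def by simp
    also have "t / c * c\<^sup>2 = c * t" using c by (simp add: power2_eq_square)
    finally show ?thesis .
  qed
  have "1 * cnj (- cnj b) * hardy_inner h (\<lambda>z. z * h z) = - (b * cnj w * of_real n)"
    unfolding i by simp
  then have re: "Re (1 * cnj (- cnj b) * hardy_inner h (\<lambda>z. z * h z)) = - (c * t * n)"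
    unfolding bw by simp
  have nf: "hardy.nsq f = (1 + c\<^sup>2 - 2 * c * t) * n"
    unfolding f_def hardy.nsq_lincomb[OF h hardy_shift(1)[OF h]] re hardy_shift(2)[OF h]
    by (simp add: c_def n_def algebra_simps)
  define Cf where "Cf = disk_swap_comp b f"
  have Cf: "Cf \<in> hardy_space" unfolding Cf_def by (rule disk_swap_comp_bounded[OF b(1) f])
  have CCf: "disk_swap_comp b Cf = f" unfolding Cf_def by (rule disk_swap_comp_involution[OF b(1) f])
  define u v where "u = (\<lambda>z. 1 * f z + 1 * Cf z)" and "v = (\<lambda>z. 1 * f z + (-1) * Cf z)"
  have u: "u \<in> hardy_space" and v: "v \<in> hardy_space" unfolding u_def v_def by (intro hardy_space_lincomb f Cf)+
  have Cu: "disk_swap_comp b u = u"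
    unfolding u_def composition_operator_lincomb CCf Cf_def[symmetric] by (simp add: fun_eq_iff)
  have Cv: "disk_swap_comp b v = (\<lambda>z. - v z)"
    unfolding v_def composition_operator_lincomb CCf Cf_def[symmetric] by (simp add: fun_eq_iff)
  have nuv: "hardy.nsq u + hardy.nsq v = 2 * (2 * (1 - c * t) * n)"
    unfolding u_def v_def hardy.nsq_lincomb[OF f Cf] nf nCf[folded Cf_def] by (simp add: algebra_simps)
  have "Re (hardy_inner u v) = hardy.nsq f - hardy.nsq Cf"
    unfolding u_def v_def hardy.ip_lincomb_both[OF f Cf] by simp
  also have "\<dots> = - (2 * (c * (t - c)) * n)"
    unfolding nf nCf[folded Cf_def] by (simp add: algebra_simps power2_eq_square)
  finally have "2 * (c * (t - c)) * n \<le> cmod (hardy_inner u v)"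
    using abs_Re_le_cmod[of "hardy_inner u v"] by simp
  moreover have "d * (1 - c * t) * (2 * n) < c * (t - c) * (2 * n)" using t(3) n by simp
  ultimately have big: "d * (2 * (1 - c * t) * n) < cmod (hardy_inner u v)" by (simp add: algebra_simps)
  have "sqrt (hardy.nsq u * hardy.nsq v) \<le> (hardy.nsq u + hardy.nsq v) / 2"
    by (intro arith_geo_mean_sqrt hardy.nsq_nonneg u v)
  also have "\<dots> = 2 * (1 - c * t) * n" unfolding nuv by (rule nonzero_mult_div_cancel_left) simp
  finally have le: "sqrt (hardy.nsq u * hardy.nsq v) \<le> 2 * (1 - c * t) * n" .
  have "e * sqrt (hardy.nsq u * hardy.nsq v) \<le> d * sqrt (hardy.nsq u * hardy.nsq v)"
    using d hardy.nsq_nonneg[OF u] hardy.nsq_nonneg[OF v] by (intro mult_right_mono) simp_all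
  also have "\<dots> \<le> d * (2 * (1 - c * t) * n)" using le d by (intro mult_left_mono)
  also note big
  finally have main: "e * sqrt (hardy.nsq u * hardy.nsq v) < cmod (hardy_inner u v)" .
  have "0 \<le> d * (2 * (1 - c * t) * n)" using d ct n by simp
  then have "0 < cmod (hardy_inner u v)" using big by linarith
  then have "0 < (cmod (hardy_inner u v))\<^sup>2" by simp
  then have "hardy.nsq u * hardy.nsq v \<noteq> 0" using hardy.cauchy_schwarz[OF u v] by linarith
  then show ?thesis using u v Cu Cv main by auto
qed

theorem numerical_range_disk_swap:
  assumes b: "b \<in> unit_disk" "b \<noteq> 0"
  shows "numerical_range hardy_space hardy_inner (disk_swap_comp b) =
    {w. (1 - (cmod b)\<^sup>2) * ((cmod b)\<^sup>2 * (Re w)\<^sup>2 + (Im w)\<^sup>2) < (cmod b)\<^sup>2}"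
proof (rule hardy.numerical_range_involution)
  show "0 < cmod b" "cmod b < 1" using b by simp_all
qed (rule disk_swap_comp_bounded(1)[OF b(1)] composition_operator_lincomb disk_swap_comp_involution[OF b(1)]
    eigenfunctions_angle[OF b] eigenfunctions_angle_sharp[OF b]; assumption)+

section \<open>Elliptic automorphisms of order two\<close>

text \<open>
  Conjugating by the automorphism \<open>m\<close> that exchanges \<open>0\<close> and \<open>a\<close> gives an involution \<open>\<psi>\<close> fixing \<open>0\<close>. The
  Schwarz lemma applied to \<open>\<psi>\<close> and to its inverse \<open>\<psi>\<close> forces equality, so \<open>\<psi>\<close> is multiplication by a square
  root of \<open>1\<close>.
\<close>
lemma elliptic_order_2_eq_disk_swap:
  assumes aut: "disk_automorphism \<phi>" and nid: "\<not> (\<forall>z\<in>unit_disk. \<phi> z = z)"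
    and inv: "\<And>z. z \<in> unit_disk \<Longrightarrow> \<phi> (\<phi> z) = z"
    and a: "a \<in> unit_disk" and fixed: "\<phi> a = a" and z: "z \<in> unit_disk"
  shows "\<phi> z = disk_swap (2 * a / of_real (1 + (cmod a)\<^sup>2)) z"
proof -
  define m where "m = disk_swap a"
  have m: "m z \<in> unit_disk" "m (m z) = z" if "z \<in> unit_disk" for z
    unfolding m_def by (rule disk_swap_in_disk[OF a that], rule disk_swap_disk_swap[OF a that])
  have \<phi>: "\<phi> z \<in> unit_disk" if "z \<in> unit_disk" for z
    using aut that unfolding disk_automorphism_def by (blast dest: bij_betwE)
  define \<psi> where "\<psi> = (\<lambda>z. m (\<phi> (m z)))"
  have mhol: "m holomorphic_on unit_disk" unfolding m_def by (rule disk_swap_holomorphic[OF a])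
  have \<phi>hol: "\<phi> holomorphic_on unit_disk" using aut by (simp add: disk_automorphism_def)
  have "(m \<circ> (\<phi> \<circ> m)) holomorphic_on unit_disk"
    by (intro holomorphic_on_compose_gen[where t = unit_disk] mhol \<phi>hol) (auto simp del: mem_ball intro: m(1) \<phi>)
  then have hol: "\<psi> holomorphic_on ball 0 1" by (simp add: \<psi>_def comp_def)
  have \<psi>0: "\<psi> 0 = 0" by (simp add: \<psi>_def m_def fixed)
  have \<psi>1: "cmod (\<psi> z) < 1" if "cmod z < 1" for z
  proof -
    have "\<psi> z \<in> unit_disk" unfolding \<psi>_def using that by (intro m(1) \<phi>) simp
    then show ?thesis by simp
  qed
  have \<psi>\<psi>: "\<psi> (\<psi> z) = z" if "z \<in> unit_disk" for z
    unfolding \<psi>_def using that by (simp only: m \<phi> inv)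
  \<comment> \<open>any nonzero point of the disk will do for the equality case of the Schwarz lemma\<close>
  define p where "p = (1/2 :: complex)"
  have p: "cmod p < 1" "p \<noteq> 0" "p \<in> unit_disk" by (simp_all add: p_def)
  have "cmod (\<psi> p) \<le> cmod p" by (rule Schwarz_Lemma(1)[OF hol \<psi>0 \<psi>1 p(1)])
  moreover have "cmod (\<psi> (\<psi> p)) \<le> cmod (\<psi> p)" by (rule Schwarz_Lemma(1)[OF hol \<psi>0 \<psi>1 \<psi>1[OF p(1)]])
  ultimately have "cmod (\<psi> p) = cmod p" using \<psi>\<psi>[OF p(3)] by simp
  then obtain \<alpha> where \<alpha>: "\<And>z. cmod z < 1 \<Longrightarrow> \<psi> z = \<alpha> * z"
    using Schwarz_Lemma(3)[OF hol \<psi>0 \<psi>1 p(1)] p by blast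
  have "\<alpha> * (\<alpha> * p) = p" using \<psi>\<psi>[OF p(3)] \<alpha>[OF p(1)] \<alpha>[OF \<psi>1[OF p(1)]] by simp
  then have "\<alpha>\<^sup>2 = 1" using p by (simp add: power2_eq_square)
  then have \<alpha>1: "\<alpha> = 1 \<or> \<alpha> = -1" by (simp add: power2_eq_1_iff)
  have \<phi>_eq: "\<phi> z = m (\<alpha> * m z)" if z: "z \<in> unit_disk" for z
  proof -
    have "\<phi> z = m (\<psi> (m z))" unfolding \<psi>_def by (simp only: m \<phi> z)
    then show ?thesis using \<alpha>[of "m z"] m(1)[OF z] by simp
  qed
  have "\<alpha> \<noteq> 1" using nid \<phi>_eq m(2) by auto
  then have "\<alpha> = -1" using \<alpha>1 by blast
  then have "\<phi> z = m (- m z)" using \<phi>_eq[OF z] by simp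
  also have "\<dots> = disk_swap (2 * a / of_real (1 + (cmod a)\<^sup>2)) z"
  proof -
    define d where "d = 1 - cnj a * z"
    define s where "s = a * cnj a"
    have d: "d \<noteq> 0" unfolding d_def by (rule one_minus_ne_0[OF a z])
    have s: "of_real (1 + (cmod a)\<^sup>2) = 1 + s" unfolding s_def complex_norm_square[symmetric] by simp
    have "1 + (cmod a)\<^sup>2 > 0" by (simp add: add_pos_nonneg)
    then have s0: "1 + s \<noteq> 0" unfolding s[symmetric] of_real_eq_0_iff by simp
    have cs: "cnj s = s" by (simp add: s_def mult.commute)
    have "a + (a - z) / d = (2 * a - (1 + s) * z) / d"
      using d by (simp add: divide_simps) (simp add: d_def s_def algebra_simps)
    moreover have "1 + cnj a * ((a - z) / d) = (1 + s - 2 * cnj a * z) / d"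
      using d by (simp add: divide_simps) (simp add: d_def s_def algebra_simps)
    ultimately have "m (- m z) = (2 * a - (1 + s) * z) / (1 + s - 2 * cnj a * z)"
      unfolding m_def disk_swap_def[of a "- _"] unfolding disk_swap_def d_def[symmetric] using d by simp
    moreover have "2 * a / (1 + s) - z = (2 * a - (1 + s) * z) / (1 + s)"
      using s0 by (simp add: divide_simps algebra_simps)
    moreover have "1 - cnj (2 * a / (1 + s)) * z = (1 + s - 2 * cnj a * z) / (1 + s)"
      using s0 by (simp add: cs divide_simps algebra_simps)
    ultimately show ?thesis unfolding s disk_swap_def using s0 by simp
  qed
  finally show ?thesis .
qed

theorem mainTheorem1:
  fixes \<phi> :: "complex \<Rightarrow> complex" and a :: complex
  assumes "elliptic_automorphism \<phi>"
    and "has_order \<phi> 2"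
    and "a \<in> unit_disk - {0}"
    and "\<phi> a = a"
  shows "numerical_range hardy_space hardy_inner (composition_operator \<phi>) =
    {w. cmod (w - 1) + cmod (w + 1) < 2 * ((1 + (cmod a)\<^sup>2) / (1 - (cmod a)\<^sup>2))}"
proof -
  define s where "s = cmod a"
  define b where "b = 2 * a / of_real (1 + s\<^sup>2)"
  have a: "a \<in> unit_disk" "a \<noteq> 0" using assms(3) by simp_all
  have s: "0 < s" "s < 1" using a by (simp_all add: s_def)
  have s1: "0 < 1 + s\<^sup>2" by (simp add: add_pos_nonneg)
  have s2: "0 < 1 - s\<^sup>2" using s by (simp add: power_less_one_iff)
  have c: "cmod b = 2 * s / (1 + s\<^sup>2)"
    unfolding b_def norm_divide norm_of_real using s1 by (simp add: norm_mult s_def)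
  have q: "1 - (cmod b)\<^sup>2 = ((1 - s\<^sup>2) / (1 + s\<^sup>2))\<^sup>2"
  proof -
    have "1 - (2 * s / (1 + s\<^sup>2))\<^sup>2 = ((1 + s\<^sup>2)\<^sup>2 - (2 * s)\<^sup>2) / (1 + s\<^sup>2)\<^sup>2"
      using s1 by (simp add: power_divide diff_divide_distrib)
    also have "(1 + s\<^sup>2)\<^sup>2 - (2 * s)\<^sup>2 = (1 - s\<^sup>2)\<^sup>2" by algebra
    finally show ?thesis unfolding c power_divide .
  qed
  have "0 < 1 - (cmod b)\<^sup>2" unfolding q using s1 s2 by simp
  then have b4: "cmod b < 1" by (simp add: power_less_one_iff)
  have b3: "0 < cmod b" unfolding c using s s1 by simp
  have b: "b \<in> unit_disk" "b \<noteq> 0" "0 < cmod b" "cmod b < 1"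
    using b3 b4 by auto
  have inv: "\<phi> (\<phi> z) = z" if "z \<in> unit_disk" for z
    using assms(2) that by (simp add: has_order_def numeral_2_eq_2)
  have "\<phi> z = disk_swap b z" if "z \<in> unit_disk" for z
    unfolding b_def s_def
    by (rule elliptic_order_2_eq_disk_swap[OF _ _ inv a(1) assms(4) that])
       (use assms(1) in \<open>simp_all add: elliptic_automorphism_def\<close>)
  then have "composition_operator \<phi> = disk_swap_comp b"
    by (auto simp: composition_operator_def fun_eq_iff)
  then have "numerical_range hardy_space hardy_inner (composition_operator \<phi>) =
      {w. (1 - (cmod b)\<^sup>2) * ((cmod b)\<^sup>2 * (Re w)\<^sup>2 + (Im w)\<^sup>2) < (cmod b)\<^sup>2}"
    using numerical_range_disk_swap[OF b(1,2)] by simp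
  also have "\<dots> = {w. cmod (w - 1) + cmod (w + 1) < 2 * ((1 + s\<^sup>2) / (1 - s\<^sup>2))}"
  proof -
    have M: "((1 + s\<^sup>2) / (1 - s\<^sup>2))\<^sup>2 * (1 - (cmod b)\<^sup>2) = 1" "0 < (1 + s\<^sup>2) / (1 - s\<^sup>2)"
      unfolding q power_mult_distrib[symmetric] using s1 s2 by simp_all
    show ?thesis unfolding ellipse_focal_iff[OF b(3,4) M] ..
  qed
  finally show ?thesis unfolding s_def .
qed

end
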